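(* Let $m\in\mathbb{Z}$ and $n\in\mathbb{Z}^+$. Suppose that $p$ is an odd prime dividing $m-4$. Then $$\nu_p\left(\sum_{k=0}^{n-1}\frac{\binom{2k}{k}}{m^k}\right)\geq \nu_p(n)\quad\text{and}\quad \nu_p\left(\sum_{k=0}^{n-1}\binom{n-1}{k}(-1)^k\frac{\binom{2k}{k}}{m^k}\right)\geq \nu_p(n).$$ Furthermore, $$\frac1n\sum_{k=0}^{n-1}\frac{\binom{2k}{k}}{m^k}\equiv\frac{\binom{2n-1}{n-1}}{4^{n-1}}+\delta_{p,3}\,[3\mid n]\,\frac{m-4}{3}\binom{2n/3^{\nu_3(n)}-1}{n/3^{\nu_3(n)}-1}\pmod{p^{\nu_p(m-4)}}$$ and also $$\frac1n\sum_{k=0}^{n-1}\binom{n-1}{k}(-1)^k\frac{\binom{2k}{k}}{m^k}\equiv\frac{C_{n-1}}{4^{n-1}}\pmod{p^{\nu_p(m-4)-\delta_{p,3}}}.$$ Thus, for every $a\in\mathbb{Z}^+$ we have $$\frac1{p^a}\sum_{k=0}^{p^a-1}\frac{\binom{2k}{k}}{m^k}\equiv 1+\delta_{p,3}\frac{m-4}{3}\equiv\frac{m-1}{3}\pmod p$$ and also, provided $p\neq 3$, $$\frac1{p^a}\sum_{k=0}^{p^a-1}\binom{p^a-1}{k}(-1)^k\frac{\binom{2k}{k}}{m^k}\equiv-1\pmod p.$$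
   Context: $\mathbb{Z}^+=\{1,2,3,\ldots\}$. For a prime $p$ and an integer $x$, $\nu_p(x)=\sup\{a\in\mathbb{Z}: p^a\mid x\}$ (so $\nu_p(0)=+\infty$), extended to rational numbers by $\nu_p(x/y)=\nu_p(x)-\nu_p(y)$ for $x\in\mathbb{Z}$, $y\in\mathbb{Z}^+$. $\delta_{p,3}$ equals $1$ if $p=3$ and $0$ otherwise; $[3\mid n]$ equals $1$ if $3$ divides $n$ and $0$ otherwise. $C_k=\frac{1}{k+1}\binom{2k}{k}$ is the $k$-th Catalan number. For rational numbers $r,s$ and an integer $e\geq 0$, $r\equiv s\pmod{p^e}$ means $\nu_p(r-s)\geq e$. When $m=4$ (so $\nu_p(m-4)=+\infty$), a congruence modulo $p^{\nu_p(m-4)}$ or $p^{\nu_p(m-4)-\delta_{p,3}}$ means congruence modulo every power of $p$, i.e. equality. *)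

theory Defs
  imports "HOL-Computational_Algebra.Primes" "HOL-Library.Extended_Real"
begin

(* sup {a. p^a dvd x}, with value \<infinity> at x = 0; negative exponents never
   affect the supremum because a = 0 is always admissible. *)
definition nu_int :: "nat \<Rightarrow> int \<Rightarrow> ereal" where
  "nu_int p x = (SUP a \<in> {a::nat. int p ^ a dvd x}. ereal (real a))"

(* Stated for the reduced fraction; by nu_rat_divide below the value does not depend
   on the fraction chosen. *)
definition nu_rat :: "nat \<Rightarrow> rat \<Rightarrow> ereal" where
  "nu_rat p r = nu_int p (fst (quotient_of r)) - nu_int p (snd (quotient_of r))"

(* r \<equiv> s (mod p^e). The exponent may be \<infinity>, in which case the
   congruence is equality (qcong_infinity below). *)
definition qcong :: "nat \<Rightarrow> ereal \<Rightarrow> rat \<Rightarrow> rat \<Rightarrow> bool" where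
  "qcong p e r s \<longleftrightarrow> nu_rat p (r - s) \<ge> e"

definition catalan :: "nat \<Rightarrow> rat" where
  "catalan k = 1 / (of_nat k + 1) * of_nat ((2 * k) choose k)"

lemma nu_int_0 [simp]: "nu_int p 0 = \<infinity>"
  unfolding nu_int_def by (simp add: SUP_nat_Infty)

lemma nu_int_eq_multiplicity:
  assumes "prime p" "x \<noteq> 0"
  shows "nu_int p x = ereal (real (multiplicity (int p) x))"
proof -
  have "\<not> is_unit (int p)"
    using assms(1) by (simp add: prime_nat_iff)
  then have "int p ^ a dvd x \<longleftrightarrow> a \<le> multiplicity (int p) x" for a
    using assms(2) by (simp add: power_dvd_iff_le_multiplicity)
  then have "nu_int p x = (SUP a \<in> {..multiplicity (int p) x}. ereal (real a))"
    unfolding nu_int_def by (simp add: atMost_def)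
  also have "\<dots> = ereal (real (multiplicity (int p) x))"
    by (rule antisym) (auto intro!: SUP_least SUP_upper)
  finally show ?thesis .
qed

lemma nu_rat_divide:
  assumes p: "prime p" and y: "y > 0"
  shows "nu_rat p (of_int x / of_int y) = nu_int p x - nu_int p y"
proof -
  obtain u w where q: "quotient_of (of_int x / of_int y) = (u, w)"
    by fastforce
  have w: "w > 0" using quotient_of_denom_pos[OF q] .
  have "(of_int x / of_int y :: rat) = of_int u / of_int w"
    using quotient_of_div[OF q] .
  then have "(of_int (x * w) :: rat) = of_int (u * y)"
    using y w by (simp add: field_simps)
  then have eq: "x * w = u * y"
    by (simp only: of_int_eq_iff)
  show ?thesis
  proof (cases "x = 0")
    case True
    then have "u = 0" using eq y by simp
    then show ?thesis
      using True p y w by (simp add: nu_rat_def q nu_int_eq_multiplicity)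
  next
    case False
    then have u: "u \<noteq> 0" using eq w by auto
    have pe: "prime_elem (int p)" using p by simp
    have "multiplicity (int p) (x * w) = multiplicity (int p) (u * y)"
      using eq by simp
    then have "multiplicity (int p) x + multiplicity (int p) w =
        multiplicity (int p) u + multiplicity (int p) y"
      using False u y w pe by (simp add: prime_elem_multiplicity_mult_distrib)
    then have "real (multiplicity (int p) x) + real (multiplicity (int p) w) =
        real (multiplicity (int p) u) + real (multiplicity (int p) y)"
      by (metis of_nat_add)
    then show ?thesis
      using False u y w p by (simp add: nu_rat_def q nu_int_eq_multiplicity)
  qed
qed

lemma qcong_infinity:
  assumes "prime p"
  shows "qcong p \<infinity> r s \<longleftrightarrow> r = s"
proof -
  obtain u w where q: "quotient_of (r - s) = (u, w)"
    by fastforce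
  have w: "w > 0" using quotient_of_denom_pos[OF q] .
  have "r - s = of_int u / of_int w" using quotient_of_div[OF q] .
  then have "u = 0 \<longleftrightarrow> r = s" using w by auto
  then show ?thesis
    using assms w
    by (cases "u = 0") (simp_all add: qcong_def nu_rat_def q nu_int_eq_multiplicity)
qed

end

(* Write m = 4 + d. Both sums, multiplied by m^(n-1), are polynomials in d:
     sum_{k<n} C(2k,k) m^(n-1-k) = n C(2n-1,n-1) sum_j C(n-1,j) b_j d^j,
     sum_{k<n} C(n-1,k) (-1)^k C(2k,k) m^(n-1-k)
       = n sum_j C(n-1,j)^2 S(n-1-j,j+1)/2 b_j d^j,
   where b_j = 1 / ((2j+1) C(2j,j)) = (j!)^2 / (2j+1)! and S(r,s) is the super Catalan number
   (2r)! (2s)! / (r! s! (r+s)!), an integer. The number b_j is a beta integral, hence an integral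
   combination of 1, 1/2, ..., 1/(2j+1). Since 2j+1 < p^j for j >= 1, except for p = 3 and j = 1,
   the number p^(j-1) b_j is p-integral and every term with j >= 1 vanishes modulo d; the only
   exception is the term with p = 3 and j = 1, where b_1 = 1/6 produces the correction (m-4)/3. *)
theory Submission
  imports Defs "HOL-Computational_Algebra.Formal_Power_Series"
begin

section \<open>Rational numbers integral at a prime\<close>

text \<open>The sum over j of C(n-1,j) b_j d^j is the integral over [0,1] of (1 + d t(1-t))^(n-1);
  integration by parts gives it a recursion in n, and this recursion is what ties it to the first
  sum. The second expansion rests instead on a Vandermonde convolution at d = 0. In both identities
  n stands apart as a factor, so division by n costs nothing, and the only denominators that can
  contain p are those of the b_j, which do not depend on n. Valuations behave badly under sums, and
  nu_p(m-4) may be infinite; the congruences are therefore proved as divisibility in the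
  localization of the integers at p, where modulus 0 means equality, and are translated to
  \<open>nu_rat\<close> only at the end. At p = 3 the surviving term is (m-4)/3 times a factor
  depending on n and m; that factor matters only modulo 3, and there it vanishes unless 3 divides
  n.\<close>

definition local_ints :: "nat \<Rightarrow> rat set" where
  "local_ints p = {of_int a / of_int b | a b. \<not> int p dvd b}"

lemma local_intsI: "\<not> int p dvd b \<Longrightarrow> of_int a / of_int b \<in> local_ints p"
  by (auto simp: local_ints_def)

text \<open>The sign is normalized because \<open>nu_rat_divide\<close> accepts positive
  denominators only.\<close>

lemma local_intsE:
  assumes "x \<in> local_ints p"
  obtains a b where "x = of_int a / of_int b" "\<not> int p dvd b" "b > 0"
proof -
  obtain a b where ab: "x = of_int a / of_int b" "\<not> int p dvd b"
    using assms by (auto simp: local_ints_def)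
  show ?thesis
  proof (cases "b > 0")
    case True
    then show ?thesis using ab that by blast
  next
    case False
    moreover have "b \<noteq> 0" using ab(2) by auto
    ultimately show ?thesis using ab that[of "- a" "- b"] by simp
  qed
qed

lemma local_ints_unit: "\<not> int p dvd b \<Longrightarrow> 1 / of_int b \<in> local_ints p"
  using local_intsI[of p b 1] by simp

lemma local_ints_inverse_nat: "\<not> p dvd b \<Longrightarrow> 1 / of_nat b \<in> local_ints p"
  using local_ints_unit[of p "int b"] by simp

lemma local_ints_of_int [simp]: "prime p \<Longrightarrow> of_int a \<in> local_ints p"
  using local_intsI[of p 1 a] by (auto simp: prime_nat_iff)

lemma local_ints_of_nat [simp]: "prime p \<Longrightarrow> of_nat a \<in> local_ints p"
  using local_ints_of_int[of p "int a"] by simp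

lemma local_ints_0 [simp]: "prime p \<Longrightarrow> 0 \<in> local_ints p"
  using local_ints_of_int[of p 0] by simp

lemma local_ints_1 [simp]: "prime p \<Longrightarrow> 1 \<in> local_ints p"
  using local_ints_of_int[of p 1] by simp

lemma local_ints_mult:
  assumes "prime p" "x \<in> local_ints p" "y \<in> local_ints p"
  shows "x * y \<in> local_ints p"
proof -
  from assms(2) obtain a b where 1: "x = of_int a / of_int b" "\<not> int p dvd b"
    by (rule local_intsE)
  from assms(3) obtain c e where 2: "y = of_int c / of_int e" "\<not> int p dvd e"
    by (rule local_intsE)
  have "\<not> int p dvd b * e" using 1 2 assms(1) by (simp add: prime_dvd_mult_iff)
  then show ?thesis
    using local_intsI[of p "b * e" "a * c"] 1 2 by simp
qed

lemma local_ints_add: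
  assumes "prime p" "x \<in> local_ints p" "y \<in> local_ints p"
  shows "x + y \<in> local_ints p"
proof -
  from assms(2) obtain a b where 1: "x = of_int a / of_int b" "\<not> int p dvd b" "b > 0"
    by (rule local_intsE)
  from assms(3) obtain c e where 2: "y = of_int c / of_int e" "\<not> int p dvd e" "e > 0"
    by (rule local_intsE)
  have "\<not> int p dvd b * e" using 1 2 assms(1) by (simp add: prime_dvd_mult_iff)
  moreover have "x + y = of_int (a * e + c * b) / of_int (b * e)"
    using 1 2 by (simp add: field_simps)
  ultimately show ?thesis
    using local_intsI by metis
qed

lemma local_ints_uminus:
  assumes "prime p" "x \<in> local_ints p"
  shows "- x \<in> local_ints p"
  using local_ints_mult[OF assms(1) local_ints_of_int[OF assms(1), of "-1"] assms(2)] by simp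

lemma local_ints_diff:
  assumes "prime p" "x \<in> local_ints p" "y \<in> local_ints p"
  shows "x - y \<in> local_ints p"
  using local_ints_add[OF assms(1,2) local_ints_uminus[OF assms(1,3)]] by simp

lemma local_ints_power:
  assumes "prime p" "x \<in> local_ints p"
  shows "x ^ k \<in> local_ints p"
  by (induction k) (simp_all add: assms local_ints_mult)

lemma local_ints_sum:
  assumes "prime p" "\<And>i. i \<in> A \<Longrightarrow> f i \<in> local_ints p"
  shows "sum f A \<in> local_ints p"
  using assms(2) by (induction A rule: infinite_finite_induct) (simp_all add: assms(1) local_ints_add)

lemma local_ints_inverse_power:
  assumes "prime p" "\<not> int p dvd m"
  shows "1 / of_int m ^ k \<in> local_ints p"
  using local_ints_power[OF assms(1) local_ints_unit[OF assms(2)], of k] by (simp add: power_divide)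

lemma local_ints_half:
  assumes "prime p" "odd p"
  shows "1 / 2 \<in> local_ints p"
proof -
  have "\<not> p dvd 2"
    using assms by (metis dvd_refl primes_dvd_imp_eq two_is_prime_nat)
  then show ?thesis using local_ints_inverse_nat[of p 2] by simp
qed

section \<open>Valuations and congruences over the localization\<close>

lemma nu_int_mono_dvd:
  assumes "x dvd y"
  shows "nu_int p x \<le> nu_int p y"
  unfolding nu_int_def using assms by (intro SUP_subset_mono) (auto intro: dvd_trans)

lemma nu_int_eq_0:
  assumes "\<not> int p dvd x"
  shows "nu_int p x = 0"
proof -
  have "{a. int p ^ a dvd x} = {0}"
  proof -
    have "a = 0" if "int p ^ a dvd x" for a
      using that assms by (cases a) (auto dest: dvd_mult_left)
    then show ?thesis by auto
  qed
  then show ?thesis by (simp add: nu_int_def zero_ereal_def)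
qed

text \<open>The passage from the localization to \<open>nu_rat\<close>: the denominator of
  \<open>t\<close> has valuation 0, so the value is that of a multiple of \<open>x\<close>. The case
  \<open>x = 0\<close> is included, with both sides infinite.\<close>

lemma nu_int_le_nu_rat:
  assumes p: "prime p" and r: "r = of_int x * t" and t: "t \<in> local_ints p"
  shows "nu_int p x \<le> nu_rat p r"
proof -
  from t obtain a b where ab: "t = of_int a / of_int b" "\<not> int p dvd b" "b > 0"
    by (rule local_intsE)
  have "nu_rat p r = nu_int p (x * a)"
    using nu_rat_divide[OF p \<open>b > 0\<close>, of "x * a"] nu_int_eq_0[OF ab(2)] r ab by simp
  then show ?thesis by (simp add: nu_int_mono_dvd)
qed

lemma nu_int_prime: "prime p \<Longrightarrow> nu_int p (int p) = 1"
  by (simp add: nu_int_eq_multiplicity prime_gt_0_nat multiplicity_self)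

lemma nu_int_times_prime:
  assumes "prime p"
  shows "nu_int p (int p * x) = nu_int p x + 1"
proof (cases "x = 0")
  case False
  with assms show ?thesis
    by (simp add: nu_int_eq_multiplicity prime_gt_0_nat prime_elem_multiplicity_mult_distrib multiplicity_self)
qed simp

text \<open>The modulus is any rational instead of a power of \<open>p\<close>: \<open>x = 0\<close>
  gives equality, so \<open>m = 4\<close> requires no separate treatment, and a congruence may be
  scaled together with its modulus.\<close>

definition local_cong :: "nat \<Rightarrow> rat \<Rightarrow> rat \<Rightarrow> rat \<Rightarrow> bool" where
  "local_cong p x r s \<longleftrightarrow> (\<exists>t\<in>local_ints p. r - s = x * t)"

lemma local_congI: "r - s = x * t \<Longrightarrow> t \<in> local_ints p \<Longrightarrow> local_cong p x r s"
  by (auto simp: local_cong_def)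

lemma local_cong_refl [simp]: "prime p \<Longrightarrow> local_cong p x r r"
  by (rule local_congI[of _ _ _ 0]) simp_all

lemma local_cong_sym:
  assumes "prime p" "local_cong p x r s"
  shows "local_cong p x s r"
proof -
  obtain t where "t \<in> local_ints p" "r - s = x * t"
    using assms(2) by (auto simp: local_cong_def)
  then show ?thesis
    by (intro local_congI[of _ _ _ "- t"]) (simp_all add: assms(1) local_ints_uminus algebra_simps)
qed

lemma local_cong_add:
  assumes "prime p" "local_cong p x r s" "local_cong p x r' s'"
  shows "local_cong p x (r + r') (s + s')"
proof -
  obtain t t' where "t \<in> local_ints p" "r - s = x * t" "t' \<in> local_ints p" "r' - s' = x * t'"
    using assms(2,3) by (auto simp: local_cong_def)
  then show ?thesis
    by (intro local_congI[of _ _ _ "t + t'"]) (simp_all add: assms(1) local_ints_add algebra_simps)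
qed

lemma local_cong_trans:
  assumes "prime p" "local_cong p x r s" "local_cong p x s u"
  shows "local_cong p x r u"
proof -
  obtain t t' where "t \<in> local_ints p" "r - s = x * t" "t' \<in> local_ints p" "s - u = x * t'"
    using assms(2,3) by (auto simp: local_cong_def)
  then show ?thesis
    by (intro local_congI[of _ _ _ "t + t'"]) (simp_all add: assms(1) local_ints_add algebra_simps)
qed

lemma local_cong_scale:
  assumes "prime p" "c \<in> local_ints p" "local_cong p x r s"
  shows "local_cong p x (c * r) (c * s)"
proof -
  obtain t where "t \<in> local_ints p" "r - s = x * t"
    using assms(3) by (auto simp: local_cong_def)
  then show ?thesis
    by (intro local_congI[of _ _ _ "c * t"])
       (simp_all add: assms local_ints_mult algebra_simps flip: right_diff_distrib)
qed

text \<open>From r r' - s s' = r (r' - s') + s' (r - s), which is why integrality is asked of one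
  factor on each side.\<close>

lemma local_cong_mult:
  assumes "prime p" "local_cong p x r s" "local_cong p x r' s'"
    and "r \<in> local_ints p" "s' \<in> local_ints p"
  shows "local_cong p x (r * r') (s * s')"
  using local_cong_scale[OF assms(1,4,3)] local_cong_scale[OF assms(1,5,2)] local_cong_trans[OF assms(1)]
  by (metis mult.commute)

lemma local_cong_power:
  assumes "prime p" "local_cong p x r s" "r \<in> local_ints p" "s \<in> local_ints p"
  shows "local_cong p x (r ^ k) (s ^ k)"
  by (induction k) (simp_all add: assms local_cong_mult local_ints_power)

lemma local_cong_sum:
  assumes "prime p" "\<And>i. i \<in> A \<Longrightarrow> local_cong p x (f i) (g i)"
  shows "local_cong p x (sum f A) (sum g A)"
  using assms(2) by (induction A rule: infinite_finite_induct) (simp_all add: assms(1) local_cong_add)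

lemma local_cong_dvd:
  assumes "prime p" "local_cong p (of_int x) r s" "y dvd x"
  shows "local_cong p (of_int y) r s"
proof -
  obtain t where t: "t \<in> local_ints p" "r - s = of_int x * t"
    using assms(2) by (auto simp: local_cong_def)
  obtain c where "x = y * c" using assms(3) by auto
  with t show ?thesis
    by (intro local_congI[of _ _ _ "of_int c * t"]) (simp_all add: assms(1) local_ints_mult)
qed

lemma local_cong_of_int:
  assumes "prime p" "x dvd a - b"
  shows "local_cong p (of_int x) (of_int a) (of_int b)"
proof -
  obtain c where "a - b = x * c" using assms(2) by auto
  then have "of_int a - of_int b = (of_int x * of_int c :: rat)"
    by (metis of_int_diff of_int_mult)
  then show ?thesis
    by (rule local_congI) (simp add: assms(1))
qed

lemma local_cong_local_ints:
  assumes "prime p" "local_cong p x r s" "s \<in> local_ints p" "x \<in> local_ints p"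
  shows "r \<in> local_ints p"
proof -
  obtain t where "t \<in> local_ints p" "r - s = x * t"
    using assms(2) by (auto simp: local_cong_def)
  then have "r = x * t + s" by simp
  then show ?thesis using assms \<open>t \<in> local_ints p\<close> by (simp add: local_ints_add local_ints_mult)
qed

lemma local_cong_mult_modulus:
  assumes "local_cong p x r s"
  shows "local_cong p (y * x) (y * r) (y * s)"
  using assms by (auto simp: local_cong_def simp flip: right_diff_distrib)

lemma local_cong_0I: "t \<in> local_ints p \<Longrightarrow> local_cong p x (x * t) 0"
  by (auto simp: local_cong_def)

lemma qcong_if_local_cong:
  assumes "prime p" "local_cong p (of_int x) r s" "e \<le> nu_int p x"
  shows "qcong p e r s"
  using assms nu_int_le_nu_rat unfolding qcong_def local_cong_def by (meson order_trans)

section \<open>Central binomial coefficients, super Catalan and beta numbers\<close>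

lemma central_binomial_fact: "(of_nat ((2 * k) choose k) :: 'a :: field_char_0) = fact (2 * k) / (fact k * fact k)"
  using binomial_fact[of k "2 * k", where 'a = 'a] by (simp add: mult_2)

lemma central_binomial_Suc:
  "(of_nat ((2 * Suc k) choose Suc k) :: 'a :: field_char_0) =
    2 * (2 * of_nat k + 1) / (of_nat k + 1) * of_nat ((2 * k) choose k)"
proof -
  have "(of_nat k + 1 :: 'a) \<noteq> 0" by (metis of_nat_Suc of_nat_neq_0 add.commute)
  then show ?thesis
    unfolding central_binomial_fact by (simp add: divide_simps) (simp add: algebra_simps)
qed

lemma central_binomial_Suc_half:
  "(of_nat ((2 * Suc k) choose Suc k) :: 'a :: field_char_0) / 2 =
    (2 * of_nat k + 1) / (of_nat k + 1) * of_nat ((2 * k) choose k)"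
proof -
  have "2 * a / b * c / 2 = a / b * c" for a b c :: 'a by simp
  then show ?thesis unfolding central_binomial_Suc .
qed

lemma central_binomial_half:
  assumes "n \<ge> 1"
  shows "(2 * n) choose n = 2 * ((2 * n - 1) choose (n - 1))"
proof -
  obtain k where n: "n = Suc k" using assms by (cases n) auto
  have "(2 * n) choose n = (Suc (2 * k) choose k) + (Suc (2 * k) choose Suc k)"
    by (simp add: n)
  also have "Suc (2 * k) choose Suc k = Suc (2 * k) choose k"
    using binomial_symmetric[of k "Suc (2 * k)"] by (simp add: Suc_diff_le mult_2)
  finally show ?thesis by (simp add: n)
qed

lemma half_central_binomial:
  assumes "n \<ge> 1"
  shows "of_nat ((2 * n) choose n) / 2 = (of_nat ((2 * n - 1) choose (n - 1)) :: 'a :: field_char_0)"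
  using central_binomial_half[OF assms] by simp

text \<open>The recursion in the second argument has integer coefficients, hence integrality. The beta
  numbers obey the same kind of recursion, so their denominators divide lcm(1, ..., a + b + 1).\<close>

definition super_catalan :: "nat \<Rightarrow> nat \<Rightarrow> rat" where
  "super_catalan r s = fact (2 * r) * fact (2 * s) / (fact r * fact s * fact (r + s))"

lemma super_catalan_rec:
  "super_catalan r (Suc s) = 4 * super_catalan r s - super_catalan (Suc r) s"
proof -
  have "(of_nat s + 1 :: rat) \<noteq> 0" "(of_nat r + 1 :: rat) \<noteq> 0" "(of_nat r + of_nat s + 1 :: rat) \<noteq> 0"
    using of_nat_neq_0[of s, where 'a = rat] of_nat_neq_0[of r, where 'a = rat]
      of_nat_neq_0[of "r + s", where 'a = rat]
    by (simp_all add: algebra_simps)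
  then show ?thesis
    unfolding super_catalan_def by (simp add: divide_simps) (simp add: algebra_simps)
qed

lemma super_catalan_Ints: "super_catalan r s \<in> \<int>"
proof (induction s arbitrary: r)
  case 0
  then show ?case by (simp add: super_catalan_def flip: central_binomial_fact)
next
  case (Suc s)
  then show ?case by (simp add: super_catalan_rec)
qed

text \<open>The integral of t^a (1-t)^b over [0,1], that is Euler's B(a+1, b+1).\<close>

definition beta_nat :: "nat \<Rightarrow> nat \<Rightarrow> rat" where
  "beta_nat a b = fact a * fact b / fact (a + b + 1)"

text \<open>Under the integral, one factor 1-t is multiplied out.\<close>

lemma beta_nat_rec: "beta_nat a (Suc b) = beta_nat a b - beta_nat (Suc a) b"
proof -
  have "(of_nat a + of_nat b + 1 :: rat) \<noteq> 0" "(of_nat a + of_nat b + 2 :: rat) \<noteq> 0"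
    using of_nat_neq_0[of "a + b", where 'a = rat] of_nat_neq_0[of "a + b + 1", where 'a = rat]
    by (simp_all add: algebra_simps)
  then show ?thesis
    unfolding beta_nat_def by (simp add: divide_simps) (simp add: algebra_simps)
qed

text \<open>Unrolling \<open>beta_nat_rec\<close> ends in values \<open>beta_nat i 0\<close> =
  1/(i+1) with i at most a+b. The free multiplier \<open>c\<close> will become a power of p.\<close>

lemma beta_nat_local_ints:
  assumes "prime p" "\<And>k. 1 \<le> k \<Longrightarrow> k \<le> a + b + 1 \<Longrightarrow> c / of_nat k \<in> local_ints p"
  shows "c * beta_nat a b \<in> local_ints p"
  using assms(2)
proof (induction b arbitrary: a)
  case 0
  have "beta_nat a 0 = 1 / of_nat (a + 1)"
    using of_nat_neq_0[of a, where 'a = rat] by (simp add: beta_nat_def divide_simps del: of_nat_Suc)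
  then show ?case using 0[of "a + 1"] by simp
next
  case (Suc b)
  have "c * beta_nat a b \<in> local_ints p" "c * beta_nat (Suc a) b \<in> local_ints p"
    using Suc by auto
  then show ?case
    by (simp add: beta_nat_rec right_diff_distrib assms(1) local_ints_diff)
qed

section \<open>Expansions in powers of m - 4\<close>

lemma beta_nat_diag_Suc:
  "beta_nat j j = 2 * (2 * of_nat j + 3) / (of_nat j + 1) * beta_nat (Suc j) (Suc j)"
proof -
  have "(of_nat j + 1 :: rat) \<noteq> 0" "(2 * of_nat j + 3 :: rat) \<noteq> 0" "(2 * of_nat j + 2 :: rat) \<noteq> 0"
    using of_nat_neq_0[of j, where 'a = rat] of_nat_neq_0[of "2 * j + 2", where 'a = rat]
    by (simp_all add: algebra_simps)
  then show ?thesis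
    unfolding beta_nat_def by (simp add: divide_simps) (simp add: algebra_simps)
qed

text \<open>This compares the coefficients of d^(j+1) in \<open>sum_beta_nat_rec\<close>: the first
  term on the right comes from the 4 in 4 + d, the second from the d.\<close>

lemma beta_nat_coeff_rec:
  fixes n :: nat
  assumes "n \<ge> 1"
  shows "(2 * of_nat n + 1) * (of_nat (n choose Suc j) * beta_nat (Suc j) (Suc j)) =
    2 * of_nat n * (of_nat ((n - 1) choose Suc j) * beta_nat (Suc j) (Suc j)) +
    of_nat n / 2 * (of_nat ((n - 1) choose j) * beta_nat j j)"
proof -
  obtain m where n: "n = Suc m" using assms by (cases n) auto
  have j: "(of_nat j + 1 :: rat) \<noteq> 0"
    using of_nat_neq_0[of j, where 'a = rat] by (simp add: algebra_simps)
  have 1: "(of_nat j + 1) * of_nat (n choose Suc j) = (of_nat n * of_nat (m choose j) :: rat)"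
    using arg_cong[OF Suc_times_binomial[of j m], of "of_nat :: nat \<Rightarrow> rat"]
    by (simp add: n algebra_simps)
  have 2: "of_nat (n choose Suc j) = (of_nat (m choose j) + of_nat (m choose Suc j) :: rat)"
    by (simp add: n)
  have 3: "of_nat n * of_nat (m choose Suc j) = (of_nat n - (of_nat j + 1)) * (of_nat (n choose Suc j) :: rat)"
    using 1 2 by (simp add: algebra_simps)
  have "2 * of_nat n * (of_nat ((n - 1) choose Suc j) * beta_nat (Suc j) (Suc j)) +
      of_nat n / 2 * (of_nat ((n - 1) choose j) * beta_nat j j) =
      2 * (of_nat n * of_nat (m choose Suc j)) * beta_nat (Suc j) (Suc j) +
      (of_nat n * of_nat (m choose j)) / 2 * beta_nat j j"
    by (simp add: n algebra_simps)
  also have "\<dots> = 2 * ((of_nat n - (of_nat j + 1)) * of_nat (n choose Suc j)) * beta_nat (Suc j) (Suc j) +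
      ((of_nat j + 1) * of_nat (n choose Suc j)) / 2 *
        (2 * (2 * of_nat j + 3) / (of_nat j + 1) * beta_nat (Suc j) (Suc j))"
    unfolding 3 1[symmetric] beta_nat_diag_Suc[of j] ..
  also have "\<dots> = (2 * of_nat n + 1) * (of_nat (n choose Suc j) * beta_nat (Suc j) (Suc j))"
    using j by (simp add: divide_simps) (simp add: algebra_simps)
  finally show ?thesis ..
qed

lemma beta_nat_0_0 [simp]: "beta_nat 0 0 = 1"
  by (simp add: beta_nat_def)

text \<open>With u = 1 + d t(1-t), \<open>g n\<close> is the integral of u^(n-1). Integrating u^n by
  parts against t - 1/2 and using d (t - 1/2)^2 = (4+d)/4 - u gives the recursion. The proof below
  is the coefficientwise version.\<close>

lemma sum_beta_nat_rec:
  fixes d :: rat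
  assumes "n \<ge> 1"
  defines "g \<equiv> \<lambda>n. \<Sum>j<n. of_nat ((n - 1) choose j) * d ^ j * beta_nat j j"
  shows "(2 * of_nat n + 1) * g (Suc n) = (4 + d) * (of_nat n / 2) * g n + 1"
proof -
  let ?b = "\<lambda>j. beta_nat j j"
  \<comment> \<open>The added term j = n is zero because n - 1 < n. With it, splitting off j = 0
    leaves a sum over j < n, aligned with the other two sums.\<close>
  have g: "g n = (\<Sum>j<Suc n. of_nat ((n - 1) choose j) * d ^ j * ?b j)"
    using assms(1) by (simp add: g_def binomial_eq_0)
  have "(4 + d) * (of_nat n / 2) * g n + 1 = 2 * of_nat n * g n + of_nat n / 2 * (d * g n) + 1"
    by (simp add: algebra_simps)
  also have "2 * of_nat n * g n = 2 * of_nat n +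
      (\<Sum>j<n. 2 * of_nat n * (of_nat ((n - 1) choose Suc j) * ?b (Suc j)) * d ^ Suc j)"
    unfolding g sum.lessThan_Suc_shift
    by (simp add: distrib_left sum_distrib_left mult_ac)
  also have "of_nat n / 2 * (d * g n) =
      (\<Sum>j<n. of_nat n / 2 * (of_nat ((n - 1) choose j) * ?b j) * d ^ Suc j)"
    by (simp add: g_def sum_distrib_left mult_ac)
  also have "2 * of_nat n + (\<Sum>j<n. 2 * of_nat n * (of_nat ((n - 1) choose Suc j) * ?b (Suc j)) * d ^ Suc j)
      + (\<Sum>j<n. of_nat n / 2 * (of_nat ((n - 1) choose j) * ?b j) * d ^ Suc j) =
      2 * of_nat n + (\<Sum>j<n. (2 * of_nat n + 1) * (of_nat (n choose Suc j) * ?b (Suc j)) * d ^ Suc j)"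
    unfolding add.assoc sum.distrib[symmetric] distrib_right[symmetric]
      beta_nat_coeff_rec[OF assms(1), symmetric] ..
  also have "\<dots> + 1 = (2 * of_nat n + 1) * g (Suc n)"
    unfolding g_def sum.lessThan_Suc_shift by (simp add: distrib_left sum_distrib_left mult_ac)
  finally show ?thesis ..
qed

text \<open>Both sides satisfy F(n+1) = (4+d) F(n) + C(2n,n): the left side by its form, the right
  side by \<open>sum_beta_nat_rec\<close> and (n+1) C(2n+2,n+1)/2 = (2n+1) C(2n,n).\<close>

lemma sum_central_binomial_expansion:
  fixes d :: rat
  shows "(\<Sum>k<n. of_nat ((2 * k) choose k) * (4 + d) ^ (n - 1 - k)) =
    of_nat n * of_nat ((2 * n) choose n) / 2 *
      (\<Sum>j<n. of_nat ((n - 1) choose j) * d ^ j * beta_nat j j)"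
proof (induction n)
  case (Suc n)
  show ?case
  \<comment> \<open>At 0 the exponent and the index \<open>n - 1\<close> are truncated, so the
    recursion starts at n = 1.\<close>
  proof (cases "n = 0")
    case False
    let ?c = "of_nat ((2 * n) choose n) :: rat"
    let ?g = "\<lambda>n. \<Sum>j<n. of_nat ((n - 1) choose j) * d ^ j * beta_nat j j"
    have "(\<Sum>k<Suc n. of_nat ((2 * k) choose k) * (4 + d) ^ (Suc n - 1 - k)) =
        (\<Sum>k<n. of_nat ((2 * k) choose k) * (4 + d) ^ (n - k)) + ?c"
      by simp
    also have "(\<Sum>k<n. of_nat ((2 * k) choose k) * (4 + d) ^ (n - k)) =
        (4 + d) * (\<Sum>k<n. of_nat ((2 * k) choose k) * (4 + d) ^ (n - 1 - k))"
      unfolding sum_distrib_left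
    proof (intro sum.cong refl)
      fix k assume "k \<in> {..<n}"
      then have "n - k = Suc (n - 1 - k)" by auto
      then show "of_nat ((2 * k) choose k) * (4 + d) ^ (n - k) =
          (4 + d) * (of_nat ((2 * k) choose k) * (4 + d) ^ (n - 1 - k))"
        by (simp only: power_Suc mult_ac)
    qed
    also have "\<dots> + ?c = ?c * ((4 + d) * (of_nat n / 2) * ?g n + 1)"
      unfolding Suc.IH by (simp add: algebra_simps)
    also have "\<dots> = ?c * ((2 * of_nat n + 1) * ?g (Suc n))"
      using sum_beta_nat_rec[of n d] False by simp
    also have "\<dots> = of_nat (Suc n) * of_nat ((2 * Suc n) choose Suc n) / 2 * ?g (Suc n)"
    proof -
      have "(of_nat n + 1 :: rat) \<noteq> 0"
        using of_nat_neq_0[of n, where 'a = rat] by (simp add: algebra_simps)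
      then show ?thesis
        unfolding central_binomial_Suc of_nat_Suc by (simp add: divide_simps) (simp add: algebra_simps)
    qed
    finally show ?thesis .
  qed simp
qed simp

section \<open>Expansion of the alternating sum\<close>

lemma central_binomial_gbinomial:
  "(of_nat ((2 * k) choose k) :: 'a :: field_char_0) = (- 4) ^ k * (- (1 / 2) gchoose k)"
proof (induction k)
  case (Suc k)
  have k: "(of_nat k + 1 :: 'a) \<noteq> 0" by (metis of_nat_Suc of_nat_neq_0 add.commute)
  have "(of_nat k + 1) * ((- (1 / 2) :: 'a) gchoose Suc k) = (- (1 / 2) - of_nat k) * (- (1 / 2) gchoose k)"
    using gbinomial_absorb_comp[of "- (1 / 2) :: 'a" k] gbinomial_absorption[of k "- (1 / 2) :: 'a"]
    by (simp add: add.commute)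
  then have rec: "((- (1 / 2) :: 'a) gchoose Suc k) = (- (1 / 2) - of_nat k) * (- (1 / 2) gchoose k) / (of_nat k + 1)"
    by (simp only: nonzero_eq_divide_eq[OF k] mult.commute)
  have k2: "(2 + of_nat k * 2 :: 'a) \<noteq> 0"
    using k by (metis add.commute distrib_right mult_1 mult_eq_0_iff zero_neq_numeral)
  show ?case
    unfolding central_binomial_Suc Suc.IH power_Suc rec using k k2 by (simp add: divide_simps) (simp add: algebra_simps)
qed simp

text \<open>Writing C(2k,k) as (-4)^k C(-1/2,k) turns the sum into 4^n times a Vandermonde
  convolution with value C(n-1/2,n), and reflecting the upper index gives (-1)^n C(-1/2,n).\<close>

lemma alternating_sum_central_binomial:
  "(\<Sum>k\<le>n. of_nat (n choose k) * (- 1) ^ k * of_nat ((2 * k) choose k) * 4 ^ (n - k)) =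
    (of_nat ((2 * n) choose n) :: 'a :: field_char_0)"
proof -
  let ?h = "- (1 / 2) :: 'a"
  have "(\<Sum>k\<le>n. of_nat (n choose k) * (- 1) ^ k * of_nat ((2 * k) choose k) * 4 ^ (n - k)) =
      (\<Sum>k\<le>n. 4 ^ n * ((?h gchoose k) * (of_nat n gchoose (n - k))))"
  proof (intro sum.cong refl)
    fix k assume "k \<in> {..n}"
    then have k: "k \<le> n" by simp
    have "(4 :: 'a) ^ n = 4 ^ k * 4 ^ (n - k)"
      using k by (simp flip: power_add)
    moreover have "(- 1 :: 'a) ^ k * (- 4) ^ k = 4 ^ k"
      by (simp flip: power_mult_distrib)
    ultimately show "of_nat (n choose k) * (- 1) ^ k * of_nat ((2 * k) choose k) * 4 ^ (n - k) =
        4 ^ n * ((?h gchoose k) * (of_nat n gchoose (n - k)))"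
      unfolding central_binomial_gbinomial
      using binomial_symmetric[OF k] by (simp add: binomial_gbinomial[symmetric] mult_ac)
  qed
  also have "\<dots> = 4 ^ n * (?h + of_nat n gchoose n)"
    unfolding sum_distrib_left[symmetric] atMost_atLeast0 gbinomial_Vandermonde ..
  also have "?h + of_nat n gchoose n = (- 1) ^ n * (?h gchoose n)"
    using gbinomial_minus[of "1 / 2 :: 'a" n] by (simp add: algebra_simps)
  also have "4 ^ n * \<dots> = of_nat ((2 * n) choose n)"
    unfolding central_binomial_gbinomial
    by (simp add: power_minus[of "4 :: 'a"])
  finally show ?thesis .
qed

text \<open>Both sides count ordered pairs of disjoint subsets of sizes k and j.\<close>

lemma binomial_mult_swap:
  assumes "j \<le> n" "k \<le> n"
  shows "(n choose k) * ((n - k) choose j) = (n choose j) * ((n - j) choose k)"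
proof (cases "k + j \<le> n")
  case True
  have "(n choose (k + j)) * ((k + j) choose k) = (n choose (k + j)) * ((k + j) choose j)"
    using binomial_symmetric[of k "k + j"] by simp
  then show ?thesis
    using True choose_mult[of k "k + j" n] choose_mult[of j "k + j" n] by simp
qed (use assms in \<open>simp add: binomial_eq_0\<close>)

text \<open>After (4+d)^(n-k) is expanded and the sums are exchanged, the coefficient of d^j
  contains the d = 0 sum for n-j in place of n.\<close>

lemma alternating_sum_central_binomial_expansion:
  fixes d :: "'a :: field_char_0"
  shows "(\<Sum>k\<le>n. of_nat (n choose k) * (- 1) ^ k * of_nat ((2 * k) choose k) * (4 + d) ^ (n - k)) =
    (\<Sum>j\<le>n. of_nat (n choose j) * d ^ j * of_nat ((2 * (n - j)) choose (n - j)))"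
proof -
  let ?f = "\<lambda>k j. of_nat (n choose k) * (- 1) ^ k * of_nat ((2 * k) choose k) *
              (of_nat ((n - k) choose j) * d ^ j * 4 ^ (n - k - j)) :: 'a"
  have "(\<Sum>k\<le>n. of_nat (n choose k) * (- 1) ^ k * of_nat ((2 * k) choose k) * (4 + d) ^ (n - k)) =
      (\<Sum>k\<le>n. \<Sum>j\<le>n - k. ?f k j)"
    by (simp only: add.commute[of 4 d] binomial_ring sum_distrib_left mult.assoc)
  \<comment> \<open>Terms with k + j > n vanish; padding with them makes the index set a square, so
    that the order of summation can be exchanged.\<close>
  also have "\<dots> = (\<Sum>k\<le>n. \<Sum>j\<le>n. ?f k j)"
    by (intro sum.cong refl sum.mono_neutral_left) (auto simp: binomial_eq_0)
  also have "\<dots> = (\<Sum>j\<le>n. \<Sum>k\<le>n. ?f k j)"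
    by (rule sum.swap)
  also have "\<dots> = (\<Sum>j\<le>n. of_nat (n choose j) * d ^ j * (\<Sum>k\<le>n - j. of_nat ((n - j) choose k) *
      (- 1) ^ k * of_nat ((2 * k) choose k) * 4 ^ (n - j - k)))"
  proof (intro sum.cong refl)
    fix j assume "j \<in> {..n}"
    then have j: "j \<le> n" by simp
    have "(\<Sum>k\<le>n. ?f k j) = (\<Sum>k\<le>n. of_nat (n choose j) * d ^ j * (of_nat ((n - j) choose k) *
      (- 1) ^ k * of_nat ((2 * k) choose k) * 4 ^ (n - j - k)))"
    proof (intro sum.cong refl)
      fix k assume "k \<in> {..n}"
      then have k: "k \<le> n" by simp
      have *: "of_nat (n choose k) * of_nat ((n - k) choose j) =
          (of_nat (n choose j) * of_nat ((n - j) choose k) :: 'a)"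
        by (simp only: of_nat_mult[symmetric] binomial_mult_swap[OF j k])
      have "?f k j = of_nat (n choose k) * of_nat ((n - k) choose j) *
          ((- 1) ^ k * of_nat ((2 * k) choose k) * d ^ j * 4 ^ (n - j - k))"
        by (simp only: diff_commute[of n k j] mult_ac)
      also have "\<dots> = of_nat (n choose j) * d ^ j * (of_nat ((n - j) choose k) *
          (- 1) ^ k * of_nat ((2 * k) choose k) * 4 ^ (n - j - k))"
        unfolding * by (simp only: mult_ac)
      finally show "?f k j = of_nat (n choose j) * d ^ j * (of_nat ((n - j) choose k) *
          (- 1) ^ k * of_nat ((2 * k) choose k) * 4 ^ (n - j - k))" .
    qed
    also have "\<dots> = (\<Sum>k\<le>n - j. of_nat (n choose j) * d ^ j * (of_nat ((n - j) choose k) *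
      (- 1) ^ k * of_nat ((2 * k) choose k) * 4 ^ (n - j - k)))"
      by (rule sum.mono_neutral_right) (auto simp: binomial_eq_0)
    finally show "(\<Sum>k\<le>n. ?f k j) = of_nat (n choose j) * d ^ j * (\<Sum>k\<le>n - j. of_nat ((n - j) choose k) *
      (- 1) ^ k * of_nat ((2 * k) choose k) * 4 ^ (n - j - k))"
      by (simp add: sum_distrib_left)
  qed
  finally show ?thesis by (simp only: alternating_sum_central_binomial)
qed

text \<open>The factor n + 1 comes out at the cost of the same denominator as in the first sum.\<close>

lemma choose_mult_central_binomial:
  assumes "j \<le> n"
  shows "of_nat (n choose j) * of_nat ((2 * (n - j)) choose (n - j)) =
    of_nat (n + 1) * ((of_nat (n choose j))\<^sup>2 * super_catalan (n - j) (Suc j) / 2 * beta_nat j j)"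
proof -
  obtain r where n: "n = j + r" using assms by (metis le_add_diff_inverse)
  have nz: "(of_nat j + 1 :: rat) \<noteq> 0" "(of_nat j + of_nat r + 1 :: rat) \<noteq> 0"
    "(2 * of_nat j + 1 :: rat) \<noteq> 0"
    using of_nat_neq_0[of j, where 'a = rat] of_nat_neq_0[of "j + r", where 'a = rat]
      of_nat_neq_0[of "2 * j", where 'a = rat]
    by (simp_all add: algebra_simps)
  have 1: "of_nat (n choose j) = (fact (j + r) / (fact j * fact r) :: rat)"
    using binomial_fact[of j n] by (simp add: n)
  have 2: "fact (r + Suc j) = (of_nat j + of_nat r + 1) * (fact (j + r) :: rat)"
  proof -
    have "r + Suc j = Suc (j + r)" by simp
    then have "fact (r + Suc j) = of_nat (Suc (j + r)) * (fact (j + r) :: rat)"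
      by (simp only: fact_Suc)
    then show ?thesis by (simp add: add.commute)
  qed
  have 3: "fact (2 * Suc j) = 2 * (of_nat j + 1) * (2 * of_nat j + 1) * (fact (2 * j) :: rat)"
  proof -
    have "2 * Suc j = Suc (Suc (2 * j))" by simp
    then have "fact (2 * Suc j) = of_nat (Suc (Suc (2 * j))) * (of_nat (Suc (2 * j)) * (fact (2 * j) :: rat))"
      by (simp only: fact_Suc)
    also have "of_nat (Suc (Suc (2 * j))) = (2 * (of_nat j + 1) :: rat)" by simp
    also have "of_nat (Suc (2 * j)) = (2 * of_nat j + 1 :: rat)" by simp
    finally show ?thesis by (simp only: mult.assoc)
  qed
  have 4: "fact (j + j + 1) = (2 * of_nat j + 1) * (fact (2 * j) :: rat)"
  proof -
    have "j + j + 1 = Suc (2 * j)" by simp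
    then have "fact (j + j + 1) = of_nat (Suc (2 * j)) * (fact (2 * j) :: rat)"
      by (simp only: fact_Suc)
    then show ?thesis by (simp add: add.commute)
  qed
  have 5: "fact (Suc j) = (of_nat j + 1) * (fact j :: rat)"
    by (simp only: fact_Suc of_nat_Suc add.commute)
  have 6: "of_nat (j + r + 1) = (of_nat j + of_nat r + 1 :: rat)" by simp
  \<comment> \<open>The factorials become free variables, leaving a pure cancellation: a, b, c, e, f
    stand for j!, r!, (2r)!, (j+r)!, (2j)! and x, y, z for j+r+1, j+1, 2j+1.\<close>
  have aux: "e / (a * b) * (c / (b * b)) =
      x * ((e / (a * b))\<^sup>2 * (c * (2 * y * z * f) / (b * (y * a) * (x * e))) / 2 * (a * a / (z * f)))"
    if "a \<noteq> 0" "b \<noteq> 0" "c \<noteq> 0" "e \<noteq> 0" "f \<noteq> 0" "x \<noteq> 0" "y \<noteq> 0" "z \<noteq> 0"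
    for a b c e f x y z :: rat
    using that by (simp add: power2_eq_square)
  show ?thesis
    unfolding 1 central_binomial_fact super_catalan_def beta_nat_def
    unfolding n add_diff_cancel_left' 2 3 4 5 6
    by (rule aux) (use nz in simp_all)
qed

text \<open>This is the coefficient at j = 0 of the second expansion, hence the Catalan number in
  the final congruence.\<close>

lemma super_catalan_1: "super_catalan n 1 / 2 = catalan n"
proof -
  have "(of_nat n + 1 :: rat) \<noteq> 0"
    using of_nat_neq_0[of n, where 'a = rat] by (simp add: algebra_simps)
  then show ?thesis
    unfolding super_catalan_def catalan_def central_binomial_fact
    by (simp add: divide_simps)
qed

section \<open>Integrality of the coefficients\<close>

lemma odd_less_power:
  assumes "odd p" "p > 1" "j \<ge> 1" "p \<noteq> 3 \<or> j \<ge> 2"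
  shows "2 * j + 1 < (p :: nat) ^ j"
proof -
  have p: "p \<ge> 3" using assms(1,2) by presburger
  \<comment> \<open>Raising the exponent by one adds 2 on the left and at least triples the right.
    The induction starts from 5 < 3^2 for p = 3 and from 3 < p otherwise.\<close>
  have *: "2 * i + 1 < q ^ i \<Longrightarrow> 2 * (i + k) + 1 < q ^ (i + k)" if "q \<ge> 3" for i k q :: nat
  proof (induction k)
    case (Suc k)
    have "2 * (i + Suc k) + 1 < 3 * q ^ (i + k)" using Suc by simp
    also have "\<dots> \<le> q * q ^ (i + k)" using that by (intro mult_right_mono) auto
    finally show ?case by simp
  qed simp
  show ?thesis
  proof (cases "p = 3")
    case True
    then have "j \<ge> 2" using assms(4) by simp
    then obtain i where "j = 2 + i" using le_Suc_ex by blast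
    then show ?thesis using *[of 3 2 i] True by simp
  next
    case False
    then have "p > 3" using p by simp
    then show ?thesis using *[of p 1 "j - 1"] assms by simp
  qed
qed

text \<open>A positive \<open>k\<close> below p^j contains at most j-1 factors p.\<close>

lemma prime_power_divide_local_ints:
  assumes "prime p" "1 \<le> k" "k < p ^ j"
  shows "of_nat p ^ (j - 1) / of_nat k \<in> local_ints p"
proof -
  have nu: "\<not> is_unit p" using assms(1) by (auto simp: prime_nat_iff)
  obtain c where c: "k = p ^ multiplicity p k * c" "\<not> p dvd c"
    using multiplicity_decompose'[of k p] assms(2) nu by (metis not_one_le_zero)
  define v where "v = multiplicity p k"
  have k: "k = p ^ v * c" using c(1) by (simp add: v_def)
  have "c > 0" using c(2) by (cases c) auto
  then have "p ^ v \<le> k" using k by simp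
  then have "p ^ v < p ^ j" using assms(3) by simp
  then have "v < j" using prime_gt_1_nat[OF assms(1)] by (rule power_less_imp_less_exp[rotated])
  then have "j - 1 = (j - 1 - v) + v" by simp
  then have "(of_nat p :: rat) ^ (j - 1) = of_nat p ^ (j - 1 - v) * of_nat p ^ v"
    by (metis power_add)
  then have "of_nat p ^ (j - 1) / of_nat k = of_nat p ^ (j - 1 - v) * (1 / of_nat c :: rat)"
    using prime_gt_0_nat[OF assms(1)] by (simp add: k)
  then show ?thesis
    using assms(1) c(2) by (simp add: local_ints_mult local_ints_power local_ints_inverse_nat del: times_divide_eq_right)
qed

text \<open>Of the j factors d, one is kept as the modulus; the other j-1 each supply a factor p,
  enough to clear the denominators up to 2j+1.\<close>

lemma local_cong_power_beta_nat:
  assumes p: "prime p" "odd p" and d: "int p dvd d" and j: "j \<ge> 1" "p \<noteq> 3 \<or> j \<ge> 2"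
  shows "local_cong p (of_int d) (of_int d ^ j * beta_nat j j) 0"
proof -
  obtain e where e: "d = int p * e" using d by auto
  have "of_nat p ^ (j - 1) * beta_nat j j \<in> local_ints p"
    using odd_less_power[OF p(2) prime_gt_1_nat[OF p(1)] j] p(1)
    by (intro beta_nat_local_ints prime_power_divide_local_ints) auto
  then have "of_int e ^ (j - 1) * (of_nat p ^ (j - 1) * beta_nat j j) \<in> local_ints p"
    by (simp add: p(1) local_ints_mult local_ints_power)
  moreover have "of_int d ^ j = (of_int d * (of_int e ^ (j - 1) * of_nat p ^ (j - 1)) :: rat)"
    using j(1) by (cases j) (simp_all add: e power_mult_distrib)
  ultimately show ?thesis
    by (intro local_congI) (simp_all add: mult_ac)
qed

lemma beta_nat_1_1: "beta_nat 1 1 = 1 / 6"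
  by (simp add: beta_nat_def fact_numeral)

text \<open>For p = 3 and j = 1 the term is d/6 = (d/3)(1/2), divisible by d/3 at 3. This is the
  source of the loss of one power of 3 in the second congruence.\<close>

lemma local_cong_power_beta_nat_weak:
  assumes p: "prime p" "odd p" and d: "int p dvd d" and j: "j \<ge> 1"
  shows "local_cong p (of_int (if p = 3 then d div 3 else d)) (of_int d ^ j * beta_nat j j) 0"
proof (cases "p = 3 \<and> j = 1")
  case True
  then obtain e where e: "d = 3 * e" using d by auto
  have "1 / of_int 2 \<in> local_ints 3" by (rule local_ints_unit) simp
  then show ?thesis
    using True by (intro local_congI[where t = "1 / 2"]) (simp_all add: e beta_nat_1_1[simplified One_nat_def])
next
  case False
  then have "local_cong p (of_int d) (of_int d ^ j * beta_nat j j) 0"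
    using j by (intro local_cong_power_beta_nat p d) auto
  then show ?thesis
    by (rule local_cong_dvd[OF p(1)]) (use d in auto)
qed

section \<open>Central binomial coefficients modulo 3\<close>

text \<open>Of the three successive ratios from 3n to 3n+3, the factor 3 in 2(3n+1)+1 cancels the
  one in 3n+3. What remains is the ratio from n to n+1 times a quotient of numbers prime to
  3.\<close>

lemma central_binomial_triple_Suc:
  "(of_nat ((2 * (3 * Suc n)) choose (3 * Suc n)) :: rat) =
    of_nat ((2 * (3 * n)) choose (3 * n)) * (2 * (2 * of_nat n + 1) / (of_nat n + 1)) *
    (4 * ((6 * of_nat n + 1) * (6 * of_nat n + 5)) / ((3 * of_nat n + 1) * (3 * of_nat n + 2)))"
proof -
  have *: "3 * Suc n = Suc (Suc (Suc (3 * n)))" by simp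
  have nz: "(of_nat n + 1 :: rat) \<noteq> 0" "(3 * of_nat n + 1 :: rat) \<noteq> 0" "(3 * of_nat n + 2 :: rat) \<noteq> 0"
    using of_nat_neq_0[of n, where 'a = rat] of_nat_neq_0[of "3 * n", where 'a = rat]
      of_nat_neq_0[of "3 * n + 1", where 'a = rat]
    by (simp_all add: algebra_simps)
  define x :: rat where "x = of_nat n"
  have e: "of_nat (3 * n) = 3 * x" "of_nat (Suc (3 * n)) = 3 * x + 1" "of_nat (Suc (Suc (3 * n))) = 3 * x + 2"
    by (simp_all add: x_def)
  have "2 * (2 * (3 * x + 2) + 1) / (3 * x + 2 + 1) * (2 * (2 * (3 * x + 1) + 1) / (3 * x + 1 + 1) *
      (2 * (2 * (3 * x) + 1) / (3 * x + 1))) =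
      2 * (2 * x + 1) / (x + 1) * (4 * ((6 * x + 1) * (6 * x + 5)) / ((3 * x + 1) * (3 * x + 2)))"
  proof -
    have 1: "3 * x + 2 + 1 = 3 * (x + 1)" "3 * x + 1 + 1 = 3 * x + 2" "2 * (3 * x + 1) + 1 = 3 * (2 * x + 1)"
      "2 * (3 * x + 2) + 1 = 6 * x + 5" "2 * (3 * x) + 1 = 6 * x + 1"
      by simp_all
    have "2 * a / (3 * u) * (2 * (3 * b) / v) * (2 * c / w) = 2 * b / u * (4 * (c * a) / (w * v))"
      for a b c u v w :: rat by (simp add: mult_ac)
    then show ?thesis unfolding 1 by (simp only: mult.assoc)
  qed
  then show ?thesis
    unfolding * central_binomial_Suc e x_def[symmetric] by (simp only: mult_ac)
qed

text \<open>The quotient is formed because the step from C(2n, n) to C(2n+2, n+1) itself is not 3-integral.\<close>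

lemma central_binomial_triple:
  "\<exists>v. local_cong 3 3 v 1 \<and> (of_nat ((2 * (3 * n)) choose (3 * n)) :: rat) = of_nat ((2 * n) choose n) * v"
proof (induction n)
  case 0
  then show ?case by (auto intro!: exI[of _ 1])
next
  case (Suc n)
  then obtain v where v: "local_cong 3 3 v 1"
    "(of_nat ((2 * (3 * n)) choose (3 * n)) :: rat) = of_nat ((2 * n) choose n) * v"
    by blast
  \<comment> \<open>\<open>N\<close> and \<open>D\<close> are, up to notation, numerator and
    denominator of the last factor in \<open>central_binomial_triple_Suc\<close>. Both are 2 modulo
    3, so their quotient is 1 modulo 3.\<close>
  define D :: nat where "D = (3 * n + 1) * (3 * n + 2)"
  define N :: nat where "N = 4 * ((6 * n + 1) * (6 * n + 5))"
  have "D mod 3 = 2"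
  proof -
    have "D = 3 * (3 * n * n + 3 * n) + 2" by (simp add: D_def algebra_simps)
    then show ?thesis by presburger
  qed
  then have D: "\<not> 3 dvd D" by presburger
  then have D0: "D \<noteq> 0" by (intro notI) simp
  have ND: "N = D + 3 * (45 * n * n + 45 * n + 6)"
    by (simp add: N_def D_def algebra_simps)
  define u :: rat where "u = of_nat N / of_nat D"
  have u_eq: "u = 4 * ((6 * of_nat n + 1) * (6 * of_nat n + 5)) / ((3 * of_nat n + 1) * (3 * of_nat n + 2))"
    by (simp add: u_def N_def D_def algebra_simps)
  have "u - 1 = 3 * (of_nat (45 * n * n + 45 * n + 6) * (1 / of_nat D))"
    unfolding u_def ND using D0 by (simp add: field_simps)
  moreover have "of_nat (45 * n * n + 45 * n + 6) * (1 / of_nat D) \<in> local_ints 3"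
    using D by (intro local_ints_mult local_ints_inverse_nat local_ints_of_nat) auto
  ultimately have u: "local_cong 3 3 u 1" by (rule local_congI)
  have "v \<in> local_ints 3"
    using local_cong_local_ints[OF _ v(1)] local_ints_of_nat[of 3 3] by simp
  then have "local_cong 3 3 (v * u) (1 * 1)"
    using v(1) u by (intro local_cong_mult) simp_all
  moreover have "(of_nat ((2 * (3 * Suc n)) choose (3 * Suc n)) :: rat) = of_nat ((2 * Suc n) choose Suc n) * (v * u)"
    unfolding central_binomial_triple_Suc v(2) central_binomial_Suc[of n] u_eq
    by (simp only: mult_ac)
  ultimately show ?case by auto
qed

lemma local_cong_central_binomial_triple:
  "local_cong 3 3 (of_nat ((2 * (3 * n)) choose (3 * n))) (of_nat ((2 * n) choose n))"
proof -
  obtain v where "local_cong 3 3 v 1"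
    "(of_nat ((2 * (3 * n)) choose (3 * n)) :: rat) = of_nat ((2 * n) choose n) * v"
    using central_binomial_triple by blast
  then show ?thesis
    using local_cong_scale[of 3 "of_nat ((2 * n) choose n)" 3 v 1] by simp
qed

lemma local_cong_central_binomial_power3:
  "local_cong 3 3 (of_nat ((2 * (3 ^ v * n)) choose (3 ^ v * n))) (of_nat ((2 * n) choose n))"
proof (induction v)
  case (Suc v)
  show ?case
    using local_cong_trans[OF _ local_cong_central_binomial_triple[of "3 ^ v * n"] Suc.IH]
    by (simp add: mult.assoc)
qed simp

section \<open>The two sums modulo powers of p\<close>

text \<open>The isolated factor \<open>of_nat n\<close> serves twice: it yields the valuation bound,
  and it cancels 1/n in the congruence.\<close>

lemma first_sum_eq:
  assumes "n \<ge> 1" "m \<noteq> 0"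
  shows "(\<Sum>k=0..n-1. of_nat ((2 * k) choose k) / of_int m ^ k) =
    of_nat n * (of_nat ((2 * n - 1) choose (n - 1)) / of_int m ^ (n - 1) *
      (\<Sum>j<n. of_nat ((n - 1) choose j) * of_int (m - 4) ^ j * beta_nat j j))"
proof -
  have "(\<Sum>k=0..n-1. of_nat ((2 * k) choose k) / of_int m ^ k) =
      (\<Sum>k<n. of_nat ((2 * k) choose k) * (4 + of_int (m - 4)) ^ (n - 1 - k) / of_int m ^ (n - 1) :: rat)"
  proof (rule sum.cong)
    fix k assume "k \<in> {..<n}"
    then have "n - 1 = k + (n - 1 - k)" by auto
    then have "(of_int m :: rat) ^ (n - 1) = of_int m ^ k * of_int m ^ (n - 1 - k)"
      by (metis power_add)
    then show "of_nat ((2 * k) choose k) / of_int m ^ k =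
        (of_nat ((2 * k) choose k) * (4 + of_int (m - 4)) ^ (n - 1 - k) / of_int m ^ (n - 1) :: rat)"
      using assms(2) by simp
  qed (use assms(1) in auto)
  also have "\<dots> = (of_nat n * of_nat ((2 * n) choose n) / 2 *
      (\<Sum>j<n. of_nat ((n - 1) choose j) * of_int (m - 4) ^ j * beta_nat j j)) / of_int m ^ (n - 1)"
    by (simp only: sum_central_binomial_expansion flip: sum_divide_distrib)
  also have "\<dots> = of_nat n * (of_nat ((2 * n) choose n) / 2 / of_int m ^ (n - 1) *
      (\<Sum>j<n. of_nat ((n - 1) choose j) * of_int (m - 4) ^ j * beta_nat j j))"
    by simp
  finally show ?thesis by (simp only: half_central_binomial[OF assms(1)])
qed

text \<open>\<open>N\<close> stands for n-1, so the factor n appears as N+1 and no truncated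
  subtraction enters.\<close>

lemma second_sum_eq:
  assumes "m \<noteq> 0"
  shows "(\<Sum>k\<le>N. of_nat (N choose k) * (- 1) ^ k * (of_nat ((2 * k) choose k) / of_int m ^ k)) =
    of_nat (N + 1) * ((\<Sum>j\<le>N. (of_nat (N choose j))\<^sup>2 * super_catalan (N - j) (Suc j) / 2 *
      (of_int (m - 4) ^ j * beta_nat j j)) / of_int m ^ N)"
proof -
  have "(\<Sum>k\<le>N. of_nat (N choose k) * (- 1) ^ k * (of_nat ((2 * k) choose k) / of_int m ^ k)) =
      (\<Sum>k\<le>N. of_nat (N choose k) * (- 1) ^ k * of_nat ((2 * k) choose k) *
        (4 + of_int (m - 4)) ^ (N - k) / of_int m ^ N :: rat)"
  proof (rule sum.cong)
    fix k assume "k \<in> {..N}"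
    then have "N = k + (N - k)" by auto
    then have "(of_int m :: rat) ^ N = of_int m ^ k * of_int m ^ (N - k)"
      by (metis power_add)
    then show "of_nat (N choose k) * (- 1) ^ k * (of_nat ((2 * k) choose k) / of_int m ^ k) =
        (of_nat (N choose k) * (- 1) ^ k * of_nat ((2 * k) choose k) *
        (4 + of_int (m - 4)) ^ (N - k) / of_int m ^ N :: rat)"
      using assms by simp
  qed simp
  also have "\<dots> = (\<Sum>j\<le>N. of_nat (N choose j) * of_int (m - 4) ^ j *
      of_nat ((2 * (N - j)) choose (N - j))) / of_int m ^ N"
    by (simp only: alternating_sum_central_binomial_expansion flip: sum_divide_distrib)
  also have "(\<Sum>j\<le>N. of_nat (N choose j) * of_int (m - 4) ^ j * of_nat ((2 * (N - j)) choose (N - j))) =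
      (\<Sum>j\<le>N. of_nat (N + 1) * ((of_nat (N choose j))\<^sup>2 * super_catalan (N - j) (Suc j) / 2 *
      (of_int (m - 4) ^ j * beta_nat j j)))"
  proof (intro sum.cong refl)
    fix j assume "j \<in> {..N}"
    then have "j \<le> N" by simp
    have "of_nat (N choose j) * of_int (m - 4) ^ j * of_nat ((2 * (N - j)) choose (N - j)) =
        of_nat (N choose j) * of_nat ((2 * (N - j)) choose (N - j)) * (of_int (m - 4) ^ j :: rat)"
      by (simp only: mult_ac)
    then show "of_nat (N choose j) * of_int (m - 4) ^ j * of_nat ((2 * (N - j)) choose (N - j)) =
        of_nat (N + 1) * ((of_nat (N choose j))\<^sup>2 * super_catalan (N - j) (Suc j) / 2 *
        (of_int (m - 4) ^ j * beta_nat j j))"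
      unfolding choose_mult_central_binomial[OF \<open>j \<le> N\<close>] by (simp only: mult_ac)
  qed
  finally show ?thesis by (simp only: times_divide_eq_right flip: sum_distrib_left)
qed

lemma power_beta_nat_local_ints:
  assumes "prime p" "odd p" "int p dvd d"
  shows "of_int d ^ j * beta_nat j j \<in> local_ints p"
proof (cases "j = 0")
  case False
  then show ?thesis
    using local_cong_local_ints[OF assms(1) local_cong_power_beta_nat_weak[OF assms, of j]] assms(1)
    by simp
qed (simp add: assms(1))

lemma first_factor_local_ints:
  assumes "prime p" "odd p" "int p dvd d"
  shows "(\<Sum>j<n. of_nat ((n - 1) choose j) * of_int d ^ j * beta_nat j j) \<in> local_ints p"
  unfolding mult.assoc
  by (intro local_ints_sum local_ints_mult power_beta_nat_local_ints local_ints_of_nat assms)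

lemma first_factor_cong:
  assumes p: "prime p" "odd p" "int p dvd d" and n: "n \<ge> 1"
  shows "local_cong p (of_int d)
    (\<Sum>j<n. of_nat ((n - 1) choose j) * of_int d ^ j * beta_nat j j)
    (1 + of_bool (p = 3) * (of_int d / 3 * ((of_nat n - 1) / 2)))"
proof -
  define X :: rat where "X = of_bool (p = 3) * (of_int d / 3 * ((of_nat n - 1) / 2))"
  have "local_cong p (of_int d)
      (\<Sum>j<n. of_nat ((n - 1) choose j) * of_int d ^ j * beta_nat j j)
      (\<Sum>j<n. (if j = 0 then 1 else 0) + (if j = 1 then X else 0))"
  proof (rule local_cong_sum[OF p(1)])
    fix j assume "j \<in> {..<n}"
    consider "j = 0" | "j = 1" "p = 3" | "j \<ge> 1" "p \<noteq> 3 \<or> j \<ge> 2" by linarith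
    then show "local_cong p (of_int d) (of_nat ((n - 1) choose j) * of_int d ^ j * beta_nat j j)
        ((if j = 0 then 1 else 0) + (if j = 1 then X else 0))"
    proof cases
      case 1
      then show ?thesis using p(1) by simp
    next
      case 2
      then have "of_nat ((n - 1) choose j) * of_int d ^ j * beta_nat j j = X"
        using n by (simp add: X_def beta_nat_1_1[simplified One_nat_def] of_nat_diff)
      then show ?thesis using 2 p(1) by simp
    next
      case 3
      have "local_cong p (of_int d) (of_nat ((n - 1) choose j) * (of_int d ^ j * beta_nat j j))
          (of_nat ((n - 1) choose j) * 0)"
        using 3 p by (intro local_cong_scale local_cong_power_beta_nat) simp_all
      \<comment> \<open>If j = 1 here, then p is not 3 and \<open>X\<close> is zero.\<close>
      moreover have "(if j = 0 then 1 else 0) + (if j = 1 then X else 0) = 0"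
        using 3 by (auto simp: X_def)
      ultimately show ?thesis by (simp add: mult.assoc)
    qed
  qed
  also have "(\<Sum>j<n. (if j = 0 then 1 else 0) + (if j = 1 then X else 0)) = 1 + X"
  \<comment> \<open>For n = 1 the index 1 lies outside the range, but then \<open>X\<close> is zero
    through its factor n-1.\<close>
  proof (cases "n = 1")
    case True
    then show ?thesis by (simp add: X_def)
  next
    case False
    then show ?thesis using n by (simp add: sum.distrib)
  qed
  finally show ?thesis by (simp add: X_def)
qed

lemma second_coefficient_local_ints:
  assumes "prime p" "odd p"
  shows "(of_nat (N choose j))\<^sup>2 * super_catalan r s / 2 \<in> local_ints p"
proof -
  obtain c where "super_catalan r s = of_int c"
    using super_catalan_Ints Ints_cases by metis
  then have "(of_nat (N choose j))\<^sup>2 * super_catalan r s / 2 =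
      of_int (int (N choose j) ^ 2 * c) * (1 / 2)"
    by simp
  also have "\<dots> \<in> local_ints p"
    by (intro local_ints_mult local_ints_of_int local_ints_half assms)
  finally show ?thesis .
qed

lemma second_factor_local_ints:
  assumes "prime p" "odd p" "int p dvd d"
  shows "(\<Sum>j\<le>N. (of_nat (N choose j))\<^sup>2 * super_catalan (N - j) (Suc j) / 2 *
    (of_int d ^ j * beta_nat j j)) \<in> local_ints p"
  by (intro local_ints_sum local_ints_mult assms power_beta_nat_local_ints second_coefficient_local_ints)

text \<open>With the weaker modulus at p = 3 every term with j >= 1 drops out, so no correction term
  appears.\<close>

lemma second_factor_cong:
  assumes p: "prime p" "odd p" "int p dvd d"
  shows "local_cong p (of_int (if p = 3 then d div 3 else d))
    (\<Sum>j\<le>N. (of_nat (N choose j))\<^sup>2 * super_catalan (N - j) (Suc j) / 2 *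
      (of_int d ^ j * beta_nat j j)) (catalan N)"
proof -
  let ?D = "of_int (if p = 3 then d div 3 else d) :: rat"
  have "local_cong p ?D
    (\<Sum>j\<le>N. (of_nat (N choose j))\<^sup>2 * super_catalan (N - j) (Suc j) / 2 * (of_int d ^ j * beta_nat j j))
    (\<Sum>j\<le>N. if j = 0 then catalan N else 0)"
  proof (rule local_cong_sum[OF p(1)])
    fix j
    show "local_cong p ?D ((of_nat (N choose j))\<^sup>2 * super_catalan (N - j) (Suc j) / 2 *
        (of_int d ^ j * beta_nat j j)) (if j = 0 then catalan N else 0)"
    proof (cases "j = 0")
      case True
      then show ?thesis using p(1) super_catalan_1[of N] by simp
    next
      case False
      then have "local_cong p ?D ((of_nat (N choose j))\<^sup>2 * super_catalan (N - j) (Suc j) / 2 *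
          (of_int d ^ j * beta_nat j j)) ((of_nat (N choose j))\<^sup>2 * super_catalan (N - j) (Suc j) / 2 * 0)"
        by (intro local_cong_scale[OF p(1) second_coefficient_local_ints] local_cong_power_beta_nat_weak p) simp
      then show ?thesis using False by simp
    qed
  qed
  then show ?thesis by simp
qed

lemma not_dvd_4:
  assumes "prime p" "odd p"
  shows "\<not> int p dvd 4"
proof
  assume "int p dvd 4"
  then have "int p dvd int (2 * 2)" by simp
  then have "p dvd 2 * 2" by (simp only: int_dvd_int_iff)
  then have "p dvd 2" using assms(1) by (metis prime_dvd_mult_iff)
  then show False using assms by (metis dvd_refl primes_dvd_imp_eq two_is_prime_nat)
qed

lemma not_dvd_if_dvd_minus_4:
  assumes "prime p" "odd p" "int p dvd m - 4"
  shows "\<not> int p dvd m"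
  using not_dvd_4[OF assms(1,2)] assms(3) dvd_diff[of "int p" m "m - 4"] by auto

lemma inverse_power_cong:
  assumes p: "prime p" "odd p" and m: "int p dvd m - 4"
  shows "local_cong p (of_int (m - 4)) (1 / of_int m ^ k) (1 / 4 ^ k)"
proof -
  have 4: "\<not> int p dvd 4" using not_dvd_4[OF p] .
  have m': "\<not> int p dvd m" by (rule not_dvd_if_dvd_minus_4[OF p m])
  have l: "1 / of_int m \<in> local_ints p" "1 / 4 \<in> local_ints p"
    using local_ints_unit[OF m'] local_ints_unit[OF 4] by simp_all
  have "m \<noteq> 0" using m' by auto
  then have "1 / of_int m - 1 / 4 = (of_int (m - 4) * - (1 / of_int m * (1 / 4)) :: rat)"
    by (simp add: field_simps)
  then have "local_cong p (of_int (m - 4)) (1 / of_int m) (1 / 4)"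
    by (rule local_congI) (intro local_ints_uminus local_ints_mult l p(1))
  then have "local_cong p (of_int (m - 4)) ((1 / of_int m) ^ k) ((1 / 4) ^ k)"
    using l p(1) by (intro local_cong_power)
  then show ?thesis by (simp add: power_divide)
qed

text \<open>All factors 3 are stripped from n by repeated use of C(6n,3n) = C(2n,n) modulo 3;
  halving is harmless because 2 is a unit at 3.\<close>

lemma local_cong_central_binomial_remove_3:
  assumes "n \<ge> 1"
  defines "n' \<equiv> n div 3 ^ multiplicity 3 n"
  shows "local_cong 3 3 (of_nat ((2 * n - 1) choose (n - 1))) (of_nat ((2 * n' - 1) choose (n' - 1)))"
proof -
  have n: "n = 3 ^ multiplicity 3 n * n'"
    by (simp add: n'_def multiplicity_dvd)
  then have "n' \<ge> 1" using assms(1) by (cases n') auto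
  have "local_cong 3 3 (1 / 2 * of_nat ((2 * (3 ^ multiplicity 3 n * n')) choose (3 ^ multiplicity 3 n * n')))
      (1 / 2 * of_nat ((2 * n') choose n'))"
    by (intro local_cong_scale local_ints_half local_cong_central_binomial_power3) simp_all
  then have "local_cong 3 3 (of_nat ((2 * n) choose n) / 2) (of_nat ((2 * n') choose n') / 2)"
    by (simp flip: n)
  then show ?thesis
    by (simp only: half_central_binomial[OF \<open>n \<ge> 1\<close>] half_central_binomial[OF \<open>n' \<ge> 1\<close>])
qed

text \<open>The cofactor of (m-4)/3 by residue of n modulo 3. For n = 0, both (n-1)/2 and the power
  of m are 1. For n = 1, the factor n-1 vanishes. For n = 2, put k = n-1: C(2n-1,n-1) = (2k+1)/(k+1)
  C(2k,k), where 3 divides 2k+1 but not k+1 = n.\<close>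

lemma first_correction_cong:
  assumes n: "n \<ge> 1" and m: "3 dvd m - 4"
  defines "n' \<equiv> n div 3 ^ multiplicity 3 n"
  shows "local_cong 3 3
    (of_nat ((2 * n - 1) choose (n - 1)) / of_int m ^ (n - 1) * ((of_nat n - 1) / 2))
    (of_bool (3 dvd n) * of_nat ((2 * n' - 1) choose (n' - 1)))"
proof -
  let ?A = "of_nat ((2 * n - 1) choose (n - 1)) :: rat"
  have pr: "prime (3::nat)" by simp
  have m3: "int 3 dvd m - 4" using m by simp
  have I: "1 / of_int m ^ (n - 1) \<in> local_ints 3"
    by (rule local_ints_inverse_power[OF pr not_dvd_if_dvd_minus_4[OF pr _ m3]]) simp
  have half: "(1 / 2 :: rat) \<in> local_ints 3" by (rule local_ints_half) simp_all
  consider q where "n = 3 * q" | q where "n = 3 * q + 1" | q where "n = 3 * q + 2"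
    by (metis add_0_right mod_div_decomp mod_less_divisor mult.commute zero_less_numeral
        less_Suc_eq less_one numeral_3_eq_3 One_nat_def one_add_one plus_1_eq_Suc)
  then show ?thesis
  proof cases
    case 1
    have "local_cong 3 (of_int (m - 4)) (1 / of_int m ^ (n - 1)) (1 / 4 ^ (n - 1))"
      by (rule inverse_power_cong[OF pr _ m3]) simp
    then have i: "local_cong 3 (of_int 3) (1 / of_int m ^ (n - 1)) (1 / 4 ^ (n - 1))"
      by (rule local_cong_dvd[OF pr]) (use m in simp)
    \<comment> \<open>The same congruence at m = 1, where m - 4 = -3, shows that the inverse power
      of 4 is 1 modulo 3.\<close>
    have "local_cong 3 (of_int 3) (1 / of_int 1 ^ (n - 1)) (1 / 4 ^ (n - 1))"
      using inverse_power_cong[OF pr, of 1 "n - 1"] local_cong_dvd[OF pr, of "-3" _ _ 3] by simp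
    from local_cong_trans[OF pr i local_cong_sym[OF pr this]]
    have i: "local_cong 3 3 (1 / of_int m ^ (n - 1)) 1" by simp
    have "(of_nat n - 1) / 2 - 1 = (3 :: rat) * (of_int (int q - 1) * (1 / 2))"
      using 1 by (simp add: field_simps)
    then have h: "local_cong 3 3 ((of_nat n - 1) / 2) 1"
      by (rule local_congI) (intro local_ints_mult local_ints_of_int half pr)
    have A: "local_cong 3 3 ?A (of_nat ((2 * n' - 1) choose (n' - 1)))"
      unfolding n'_def by (rule local_cong_central_binomial_remove_3[OF n])
    have "local_cong 3 3 (?A * (1 / of_int m ^ (n - 1))) (of_nat ((2 * n' - 1) choose (n' - 1)) * 1)"
      by (intro local_cong_mult A i) simp_all
    then have "local_cong 3 3 (?A * (1 / of_int m ^ (n - 1)) * ((of_nat n - 1) / 2))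
        (of_nat ((2 * n' - 1) choose (n' - 1)) * 1 * 1)"
      by (rule local_cong_mult[OF pr _ h]) (intro local_ints_mult I local_ints_of_nat pr, simp)
    then show ?thesis using 1 by (simp only: mult_1_right times_divide_eq_right) simp
  next
    case 2
    have "local_cong 3 3 (3 * (?A * (1 / of_int m ^ (n - 1)) * (of_nat q * (1 / 2)))) 0"
      by (intro local_cong_0I local_ints_mult I half) simp_all
    moreover have "\<not> 3 dvd n" using 2 by presburger
    ultimately show ?thesis using 2 by (simp add: mult_ac)
  next
    case 3
    define k where "k = n - 1"
    have k: "n = Suc k" "k = 3 * q + 1" using 3 by (simp_all add: k_def)
    have nd: "\<not> 3 dvd n" using 3 by presburger
    have "?A = of_nat ((2 * n) choose n) / 2"
      by (rule half_central_binomial[OF n, symmetric])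
    also have "\<dots> = (2 * of_nat k + 1) / (of_nat k + 1) * of_nat ((2 * k) choose k)"
      unfolding k(1) by (rule central_binomial_Suc_half)
    also have "(2 * of_nat k + 1) / (of_nat k + 1) = (3 * (of_nat (2 * q + 1) * (1 / of_nat n)) :: rat)"
      by (simp add: k)
    finally have A: "?A = 3 * (of_nat (2 * q + 1) * (1 / of_nat n) * of_nat ((2 * k) choose k))"
      by (simp only: mult.assoc)
    have "local_cong 3 3 (3 * (of_nat (2 * q + 1) * (1 / of_nat n) * of_nat ((2 * k) choose k) *
        (1 / of_int m ^ (n - 1)) * (of_int (int n - 1) * (1 / 2)))) 0"
      by (intro local_cong_0I local_ints_mult I half local_ints_inverse_nat nd local_ints_of_int local_ints_of_nat pr)
    also have "3 * (of_nat (2 * q + 1) * (1 / of_nat n) * of_nat ((2 * k) choose k) *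
        (1 / of_int m ^ (n - 1)) * (of_int (int n - 1) * (1 / 2))) =
        ?A / of_int m ^ (n - 1) * ((of_nat n - 1) / 2)"
      unfolding A by simp
    finally show ?thesis using nd by simp
  qed
qed

lemma first_sum_cong:
  assumes p: "prime p" "odd p" "int p dvd m - 4" and n: "n \<ge> 1"
  shows "local_cong p (of_int (m - 4))
    (1 / of_nat n * (\<Sum>k=0..n-1. of_nat ((2 * k) choose k) / of_int m ^ k))
    (of_nat ((2 * n - 1) choose (n - 1)) / 4 ^ (n - 1)
      + of_bool (p = 3) * of_bool (3 dvd n) * (of_int (m - 4) / 3) *
        of_nat ((2 * (n div 3 ^ multiplicity 3 n) - 1) choose (n div 3 ^ multiplicity 3 n - 1)))"
    (is "local_cong p ?d ?L (_ + ?R)")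
proof -
  let ?A = "of_nat ((2 * n - 1) choose (n - 1)) :: rat"
  let ?W = "\<Sum>j<n. of_nat ((n - 1) choose j) * of_int (m - 4) ^ j * beta_nat j j"
  have nm: "\<not> int p dvd m" by (rule not_dvd_if_dvd_minus_4[OF p])
  then have "m \<noteq> 0" by auto
  have I: "1 / of_int m ^ (n - 1) \<in> local_ints p" by (rule local_ints_inverse_power[OF p(1) nm])
  have "?L = ?A * (1 / of_int m ^ (n - 1)) * ?W"
    unfolding first_sum_eq[OF n \<open>m \<noteq> 0\<close>] using n by simp
  also have "local_cong p ?d \<dots>
      (?A * (1 / of_int m ^ (n - 1)) * (1 + of_bool (p = 3) * (?d / 3 * ((of_nat n - 1) / 2))))"
    by (intro local_cong_scale first_factor_cong local_ints_mult p n I local_ints_of_nat)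
  also have "?A * (1 / of_int m ^ (n - 1)) * (1 + of_bool (p = 3) * (?d / 3 * ((of_nat n - 1) / 2))) =
      ?A * (1 / of_int m ^ (n - 1)) +
      of_bool (p = 3) * (?d / 3 * (?A / of_int m ^ (n - 1) * ((of_nat n - 1) / 2)))"
    by (simp add: distrib_left mult_ac)
  finally have 1: "local_cong p ?d ?L (?A * (1 / of_int m ^ (n - 1)) +
      of_bool (p = 3) * (?d / 3 * (?A / of_int m ^ (n - 1) * ((of_nat n - 1) / 2))))" .
  have 2: "local_cong p ?d (of_bool (p = 3) * (?d / 3 * (?A / of_int m ^ (n - 1) * ((of_nat n - 1) / 2)))) ?R"
  proof (cases "p = 3")
    case True
    then have "3 dvd m - 4" using p(3) by simp
    \<comment> \<open>Multiplying a congruence modulo 3 by d/3 gives one modulo d; the equation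
      rewrites the resulting modulus.\<close>
    have "?d / 3 * 3 = ?d" by simp
    from local_cong_mult_modulus[OF first_correction_cong[OF n \<open>3 dvd m - 4\<close>], of "?d / 3", unfolded this]
    show ?thesis using True by (simp add: mult_ac)
  qed (simp add: p(1))
  have "local_cong p ?d (?A * (1 / of_int m ^ (n - 1))) (?A * (1 / 4 ^ (n - 1)))"
    by (intro local_cong_scale inverse_power_cong p local_ints_of_nat)
  then have "local_cong p ?d (?A * (1 / of_int m ^ (n - 1)) +
      of_bool (p = 3) * (?d / 3 * (?A / of_int m ^ (n - 1) * ((of_nat n - 1) / 2)))) (?A * (1 / 4 ^ (n - 1)) + ?R)"
    using 2 by (rule local_cong_add[OF p(1)])
  from local_cong_trans[OF p(1) 1 this] show ?thesis
    by (simp only: times_divide_eq_right mult_1_right)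
qed

lemma second_sum_cong:
  assumes p: "prime p" "odd p" "int p dvd m - 4" and n: "n \<ge> 1"
  shows "local_cong p (of_int (if p = 3 then (m - 4) div 3 else m - 4))
    (1 / of_nat n * (\<Sum>k=0..n-1. of_nat ((n - 1) choose k) * (- 1) ^ k *
      (of_nat ((2 * k) choose k) / of_int m ^ k)))
    (catalan (n - 1) / 4 ^ (n - 1))"
    (is "local_cong p ?D ?L _")
proof -
  let ?V = "\<Sum>j\<le>n-1. (of_nat ((n - 1) choose j))\<^sup>2 * super_catalan (n - 1 - j) (Suc j) / 2 *
    (of_int (m - 4) ^ j * beta_nat j j)"
  have nm: "\<not> int p dvd m" by (rule not_dvd_if_dvd_minus_4[OF p])
  then have "m \<noteq> 0" by auto
  have I: "1 / of_int m ^ (n - 1) \<in> local_ints p" by (rule local_ints_inverse_power[OF p(1) nm])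
  have "local_cong p (of_int (m - 4)) (1 / of_int m ^ (n - 1)) (1 / 4 ^ (n - 1))"
    by (intro inverse_power_cong p)
  then have i: "local_cong p ?D (1 / of_int m ^ (n - 1)) (1 / 4 ^ (n - 1))"
    by (rule local_cong_dvd[OF p(1)]) (use p(3) in auto)
  have i4: "1 / 4 ^ (n - 1) \<in> local_ints p"
    using local_ints_inverse_power[OF p(1) not_dvd_4[OF p(1,2)], of "n - 1"] by simp
  have "?L = ?V * (1 / of_int m ^ (n - 1))"
    unfolding atLeast0AtMost second_sum_eq[OF \<open>m \<noteq> 0\<close>] using n by simp
  moreover have "local_cong p ?D (?V * (1 / of_int m ^ (n - 1))) (catalan (n - 1) * (1 / 4 ^ (n - 1)))"
    by (rule local_cong_mult[OF p(1) second_factor_cong[OF p] i second_factor_local_ints[OF p] i4])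
  ultimately show ?thesis by simp
qed

section \<open>Indices that are powers of p\<close>

text \<open>Since i C(q,i) = q C(q-1,i-1) for q = p^a, a binomial coefficient prime to p would force
  p^a to divide i.\<close>

lemma prime_dvd_choose_prime_power:
  assumes "prime p" "0 < i" "i < p ^ a"
  shows "p dvd (p ^ a choose i)"
proof (rule ccontr)
  assume "\<not> p dvd (p ^ a choose i)"
  then have "coprime (p ^ a) (p ^ a choose i)"
    using assms(1) by (simp add: prime_imp_coprime)
  moreover have "p ^ a dvd i * (p ^ a choose i)"
    using binomial_absorption[of "i - 1" "p ^ a"] assms(2) by simp
  ultimately have "p ^ a dvd i" using coprime_dvd_mult_left_iff by blast
  then show False using assms by (auto dest: dvd_imp_le)
qed

lemma dvd_sum_minus_ends:
  fixes f :: "nat \<Rightarrow> int"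
  assumes "q \<ge> 1" "\<And>i. 0 < i \<Longrightarrow> i < q \<Longrightarrow> c dvd f i"
  shows "c dvd (\<Sum>i\<le>q. f i) - (f 0 + f q)"
proof -
  have "{..q} = insert 0 (insert q {0<..<q})" by auto
  then have "(\<Sum>i\<le>q. f i) - (f 0 + f q) = (\<Sum>i\<in>{0<..<q}. f i)"
    using assms(1) by simp
  also have "c dvd \<dots>" by (rule dvd_sum) (use assms(2) in auto)
  finally show ?thesis .
qed

text \<open>In the row sum 2^q of the binomial coefficients only the two end terms survive modulo
  p.\<close>

lemma two_power_prime_power:
  assumes "prime p"
  shows "int p dvd 2 ^ (p ^ a) - 2"
proof -
  define q where "q = p ^ a"
  have q: "q \<ge> 1" "\<And>i. 0 < i \<Longrightarrow> i < q \<Longrightarrow> int p dvd int (q choose i)"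
    using prime_gt_0_nat[OF assms] prime_dvd_choose_prime_power[OF assms]
    by (simp_all add: q_def Suc_leI)
  have "(\<Sum>i\<le>q. int (q choose i)) = int (2 ^ q)"
    by (simp only: choose_row_sum flip: of_nat_sum)
  then show ?thesis
    using dvd_sum_minus_ends[of q "int p" "\<lambda>i. int (q choose i)"] q by (simp add: q_def)
qed

text \<open>The same argument applied to the sum of the squared row.\<close>

lemma central_binomial_prime_power:
  assumes "prime p"
  shows "int p dvd int ((2 * p ^ a) choose (p ^ a)) - 2"
proof -
  define q where "q = p ^ a"
  have q: "q \<ge> 1" "\<And>i. 0 < i \<Longrightarrow> i < q \<Longrightarrow> int p dvd int ((q choose i)\<^sup>2)"
    using prime_gt_0_nat[OF assms] prime_dvd_choose_prime_power[OF assms]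
    by (simp_all add: q_def Suc_leI power2_eq_square)
  have "(\<Sum>i\<le>q. int ((q choose i)\<^sup>2)) = int ((2 * q) choose q)"
    by (simp only: choose_square_sum flip: of_nat_sum)
  then show ?thesis
    using dvd_sum_minus_ends[of q "int p" "\<lambda>i. int ((q choose i)\<^sup>2)"] q by (simp add: q_def)
qed

lemma half_central_binomial_prime_power_cong:
  assumes "prime p" "odd p"
  shows "local_cong p (of_nat p) (of_nat ((2 * p ^ a - 1) choose (p ^ a - 1))) 1"
proof -
  have "p ^ a \<ge> 1" using prime_gt_0_nat[OF assms(1)] by (simp add: Suc_leI)
  have "local_cong p (of_int (int p)) (of_int (int ((2 * p ^ a) choose (p ^ a)))) (of_int 2)"
    by (intro local_cong_of_int central_binomial_prime_power assms)
  then have "local_cong p (of_nat p) (1 / 2 * of_nat ((2 * p ^ a) choose (p ^ a))) (1 / 2 * 2)"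
    by (intro local_cong_scale local_ints_half assms) simp
  then show ?thesis
    using half_central_binomial[OF \<open>p ^ a \<ge> 1\<close>, where 'a = rat] by simp
qed

text \<open>Squaring 2^q = 2 modulo p gives 4^q = 4, and the claim follows on dividing by 4^q, a
  unit at p.\<close>

lemma inverse_4_power_prime_power_cong:
  assumes "prime p" "odd p"
  shows "local_cong p (of_nat p) (1 / 4 ^ (p ^ a - 1)) 1"
proof -
  let ?q = "p ^ a"
  have q: "?q = Suc (?q - 1)" using prime_gt_0_nat[OF assms(1)] by simp
  obtain c where c: "2 ^ ?q - 2 = int p * c"
    using two_power_prime_power[OF assms(1)] by auto
  have "(4 :: int) ^ ?q = (2 ^ ?q)\<^sup>2" by (simp add: power2_eq_square flip: power_mult_distrib)
  also have "2 ^ ?q = int p * c + 2" using c by simp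
  finally have "4 ^ ?q - 4 = int p * (c * (int p * c + 4))"
    by (simp add: power2_eq_square algebra_simps)
  then have "of_int (4 ^ ?q - 4) = (of_int (int p * (c * (int p * c + 4))) :: rat)" by simp
  then have e: "4 ^ ?q - 4 = (of_nat p * of_int (c * (int p * c + 4)) :: rat)" by simp
  have "1 / 4 ^ (?q - 1) = (4 / 4 ^ ?q :: rat)"
    by (subst (2) q) simp
  then have "1 / 4 ^ (?q - 1) - 1 = - (4 ^ ?q - 4) * (1 / 4 ^ ?q :: rat)"
    by (simp add: field_simps)
  also have "\<dots> = of_nat p * (of_int (- (c * (int p * c + 4))) * (1 / of_int 4 ^ ?q))"
    unfolding e by simp
  finally show ?thesis
    by (rule local_congI)
      (intro local_ints_mult local_ints_of_int local_ints_inverse_power not_dvd_4 assms)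
qed

text \<open>For k = p^a - 1 the half central binomial coefficient, which is 1 modulo p, equals
  (2k+1) C_k, and 2k+1 = 2p^a - 1 is -1 modulo p.\<close>

lemma catalan_prime_power_cong:
  assumes "prime p" "odd p" "a \<ge> 1"
  shows "local_cong p (of_nat p) (catalan (p ^ a - 1)) (- 1)"
proof -
  define k where "k = p ^ a - 1"
  have q: "p ^ a = Suc k" using prime_gt_0_nat[OF assms(1)] by (simp add: k_def)
  obtain b where b: "p ^ a = p * b" using assms(3) by (cases a) auto
  have cat: "catalan k \<in> local_ints p"
  proof -
    \<comment> \<open>The factor C(k,0) = 1 is inserted to match the form of
      \<open>second_coefficient_local_ints\<close>.\<close>
    have "catalan k = (of_nat (k choose 0))\<^sup>2 * super_catalan k 1 / 2"
      using super_catalan_1[of k] by simp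
    also have "\<dots> \<in> local_ints p" by (intro second_coefficient_local_ints assms)
    finally show ?thesis .
  qed
  have "of_nat ((2 * p ^ a - 1) choose (p ^ a - 1)) = (of_nat ((2 * Suc k) choose Suc k) / 2 :: rat)"
    using half_central_binomial[of "Suc k", where 'a = rat] by (simp only: q)
  also have "\<dots> = (2 * of_nat k + 1) * catalan k"
    unfolding central_binomial_Suc_half catalan_def by simp
  also have "\<dots> = 2 * of_nat (Suc k) * catalan k - catalan k"
    by (simp add: algebra_simps)
  also have "\<dots> = of_nat p * (2 * of_nat b * catalan k) - catalan k"
    unfolding q[symmetric] b by simp
  finally have "- 1 - catalan k = of_nat ((2 * p ^ a - 1) choose (p ^ a - 1)) - 1
      + of_nat p * - (2 * of_nat b * catalan k)"
    by simp
  moreover obtain t where "t \<in> local_ints p"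
    "of_nat ((2 * p ^ a - 1) choose (p ^ a - 1)) - 1 = of_nat p * t"
    using half_central_binomial_prime_power_cong[OF assms(1,2)] by (auto simp: local_cong_def)
  ultimately have "- 1 - catalan k = of_nat p * (t + - (of_int 2 * of_nat b * catalan k))"
    by (simp add: algebra_simps)
  then have "local_cong p (of_nat p) (- 1) (catalan k)"
    by (rule local_congI)
      (intro \<open>t \<in> local_ints p\<close> local_ints_add local_ints_uminus local_ints_mult cat assms local_ints_of_int local_ints_of_nat)
  then show ?thesis unfolding k_def by (rule local_cong_sym[OF assms(1)])
qed

theorem theorem1p1:
  fixes m :: int and n p :: nat
  assumes "n \<ge> 1" and "prime p" and "odd p" and "int p dvd m - 4"
  shows
    "nu_rat p (\<Sum>k=0..n-1. of_nat ((2 * k) choose k) / of_int m ^ k) \<ge> nu_int p (int n)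
   \<and> nu_rat p (\<Sum>k=0..n-1. of_nat ((n - 1) choose k) * (- 1) ^ k *
          (of_nat ((2 * k) choose k) / of_int m ^ k)) \<ge> nu_int p (int n)
   \<and> qcong p (nu_int p (m - 4))
        (1 / of_nat n * (\<Sum>k=0..n-1. of_nat ((2 * k) choose k) / of_int m ^ k))
        (of_nat ((2 * n - 1) choose (n - 1)) / 4 ^ (n - 1)
          + of_bool (p = 3) * of_bool (3 dvd n) * (of_int (m - 4) / 3) *
            of_nat ((2 * (n div 3 ^ multiplicity 3 n) - 1) choose
                    (n div 3 ^ multiplicity 3 n - 1)))
   \<and> qcong p (nu_int p (m - 4) - of_bool (p = 3))
        (1 / of_nat n * (\<Sum>k=0..n-1. of_nat ((n - 1) choose k) * (- 1) ^ k *
          (of_nat ((2 * k) choose k) / of_int m ^ k)))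
        (catalan (n - 1) / 4 ^ (n - 1))
   \<and> (\<forall>a::nat. a \<ge> 1 \<longrightarrow>
        qcong p 1
          (1 / of_nat (p ^ a) * (\<Sum>k=0..p^a-1. of_nat ((2 * k) choose k) / of_int m ^ k))
          (1 + of_bool (p = 3) * (of_int (m - 4) / 3))
      \<and> qcong p 1 (1 + of_bool (p = 3) * (of_int (m - 4) / 3)) (of_int (m - 1) / 3)
      \<and> (p \<noteq> 3 \<longrightarrow>
          qcong p 1
            (1 / of_nat (p ^ a) * (\<Sum>k=0..p^a-1. of_nat ((p ^ a - 1) choose k) * (- 1) ^ k *
              (of_nat ((2 * k) choose k) / of_int m ^ k)))
            (- 1)))"
proof -
  note p = assms(2-4) and n = assms(1)
  let ?S = "\<lambda>n. \<Sum>k=0..n-1. of_nat ((2 * k) choose k) / of_int m ^ k :: rat"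
  let ?T = "\<lambda>n. \<Sum>k=0..n-1. of_nat ((n - 1) choose k) * (- 1) ^ k *
    (of_nat ((2 * k) choose k) / of_int m ^ k) :: rat"
  let ?D = "if p = 3 then (m - 4) div 3 else m - 4"
  have nm: "\<not> int p dvd m" by (rule not_dvd_if_dvd_minus_4[OF p])
  then have "m \<noteq> 0" by auto
  have I: "1 / of_int m ^ k \<in> local_ints p" for k by (rule local_ints_inverse_power[OF p(1) nm])
  have i4: "1 / 4 ^ k \<in> local_ints p" for k
    using local_ints_inverse_power[OF p(1) not_dvd_4[OF p(1,2)], of k] by simp
  have 1: "nu_rat p (?S n) \<ge> nu_int p (int n)"
  proof (rule nu_int_le_nu_rat[OF p(1)])
    let ?W = "\<Sum>j<n. of_nat ((n - 1) choose j) * of_int (m - 4) ^ j * beta_nat j j"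
    show "?S n = of_int (int n) * (of_nat ((2 * n - 1) choose (n - 1)) * (1 / of_int m ^ (n - 1)) * ?W)"
      unfolding first_sum_eq[OF n \<open>m \<noteq> 0\<close>] by simp
    show "of_nat ((2 * n - 1) choose (n - 1)) * (1 / of_int m ^ (n - 1)) * ?W \<in> local_ints p"
      by (intro local_ints_mult first_factor_local_ints local_ints_of_nat I p)
  qed
  have 2: "nu_rat p (?T n) \<ge> nu_int p (int n)"
  proof (rule nu_int_le_nu_rat[OF p(1)])
    let ?V = "\<Sum>j\<le>n-1. (of_nat ((n - 1) choose j))\<^sup>2 * super_catalan (n - 1 - j) (Suc j) / 2 *
      (of_int (m - 4) ^ j * beta_nat j j)"
    show "?T n = of_int (int n) * (?V * (1 / of_int m ^ (n - 1)))"
      unfolding atLeast0AtMost second_sum_eq[OF \<open>m \<noteq> 0\<close>] using n by simp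
    show "?V * (1 / of_int m ^ (n - 1)) \<in> local_ints p"
      by (intro local_ints_mult second_factor_local_ints I p)
  qed
  \<comment> \<open>Dividing by 3 lowers the valuation by exactly one; for m = 4 both valuations are
    infinite and the inequality persists.\<close>
  have D: "nu_int p (m - 4) - of_bool (p = 3) \<le> nu_int p ?D"
  proof (cases "p = 3")
    case True
    then have "m - 4 = int p * ?D" using p(3) by simp
    then have "nu_int p (m - 4) = nu_int p ?D + 1" using nu_int_times_prime[OF p(1)] by metis
    then show ?thesis using True by (cases "nu_int p ?D") (simp_all add: one_ereal_def)
  qed simp
  have pow: "qcong p 1 (1 / of_nat (p ^ a) * ?S (p ^ a)) (1 + of_bool (p = 3) * (of_int (m - 4) / 3))"
      "p \<noteq> 3 \<longrightarrow> qcong p 1 (1 / of_nat (p ^ a) * ?T (p ^ a)) (- 1)"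
    if a: "a \<ge> 1" for a
  proof -
    let ?q = "p ^ a"
    have q: "?q \<ge> 1" using prime_gt_0_nat[OF p(1)] by (simp add: Suc_leI)
    have inv4: "local_cong p (of_nat p) (1 / 4 ^ (?q - 1)) 1"
      by (rule inverse_4_power_prime_power_cong[OF p(1,2)])
    have qcongI: "qcong p 1 r s" if "local_cong p (of_int (int p)) r s" for r s
      using qcong_if_local_cong[OF p(1) that] nu_int_prime[OF p(1)] by simp
    \<comment> \<open>For p = 3, stripping the factors 3 from 3^a leaves 1, so the binomial
      coefficient is C(1,0) = 1.\<close>
    have corr: "of_bool (p = 3) * of_bool (3 dvd ?q) * (of_int (m - 4) / 3) *
        of_nat ((2 * (?q div 3 ^ multiplicity 3 ?q) - 1) choose (?q div 3 ^ multiplicity 3 ?q - 1)) =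
        (of_bool (p = 3) * (of_int (m - 4) / 3) :: rat)"
      using a by (cases "p = 3") simp_all
    have "local_cong p (of_nat p) (of_nat ((2 * ?q - 1) choose (?q - 1)) * (1 / 4 ^ (?q - 1))) (1 * 1)"
      by (intro local_cong_mult half_central_binomial_prime_power_cong inv4 p local_ints_of_nat local_ints_1)
    then have "local_cong p (of_int (int p)) (of_nat ((2 * ?q - 1) choose (?q - 1)) / 4 ^ (?q - 1)) 1"
      by simp
    then have "local_cong p (of_int (int p)) (of_nat ((2 * ?q - 1) choose (?q - 1)) / 4 ^ (?q - 1) +
        of_bool (p = 3) * (of_int (m - 4) / 3)) (1 + of_bool (p = 3) * (of_int (m - 4) / 3))"
      by (intro local_cong_add local_cong_refl p)
    with local_cong_dvd[OF p(1) first_sum_cong[OF p q] p(3), unfolded corr]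
    have "local_cong p (of_int (int p)) (1 / of_nat ?q * ?S ?q) (1 + of_bool (p = 3) * (of_int (m - 4) / 3))"
      by (rule local_cong_trans[OF p(1)])
    then show "qcong p 1 (1 / of_nat ?q * ?S ?q) (1 + of_bool (p = 3) * (of_int (m - 4) / 3))"
      by (rule qcongI)
    show "p \<noteq> 3 \<longrightarrow> qcong p 1 (1 / of_nat ?q * ?T ?q) (- 1)"
    proof
      assume "p \<noteq> 3"
      then have "int p dvd ?D" using p(3) by simp
      from local_cong_dvd[OF p(1) second_sum_cong[OF p q] this]
      have 1: "local_cong p (of_int (int p)) (1 / of_nat ?q * ?T ?q) (catalan (?q - 1) / 4 ^ (?q - 1))" .
      have "local_cong p (of_nat p) (1 / 4 ^ (?q - 1) * catalan (?q - 1)) (1 * - 1)"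
        by (intro local_cong_mult catalan_prime_power_cong inv4 p a i4 local_ints_uminus local_ints_1)
      then have "local_cong p (of_int (int p)) (catalan (?q - 1) / 4 ^ (?q - 1)) (- 1)"
        by simp
      with 1 have "local_cong p (of_int (int p)) (1 / of_nat ?q * ?T ?q) (- 1)"
        by (rule local_cong_trans[OF p(1)])
      then show "qcong p 1 (1 / of_nat ?q * ?T ?q) (- 1)" by (rule qcongI)
    qed
  qed
  have "qcong p 1 (1 + of_bool (p = 3) * (of_int (m - 4) / 3)) (of_int (m - 1) / 3)"
  proof (rule qcong_if_local_cong[OF p(1)])
    \<comment> \<open>At p = 3 the two sides are equal. Otherwise they differ by (m-4)/3, a multiple
      of p because 3 is a unit at p.\<close>
    show "local_cong p (of_int (int p)) (1 + of_bool (p = 3) * (of_int (m - 4) / 3)) (of_int (m - 1) / 3)"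
    proof (cases "p = 3")
      case True
      then have "1 + of_bool (p = 3) * (of_int (m - 4) / 3) = (of_int (m - 1) / 3 :: rat)"
        by (simp add: field_simps)
      then show ?thesis using p(1) by (simp only: local_cong_refl)
    next
      case False
      have "\<not> int p dvd 3"
      proof
        assume "int p dvd 3"
        then have "int p dvd int 3" by simp
        then have "p dvd 3" by (simp only: int_dvd_int_iff)
        then show False using False p(1) primes_dvd_imp_eq[of p 3] by simp
      qed
      then have 3: "1 / 3 \<in> local_ints p" using local_ints_unit by fastforce
      obtain c where "m - 4 = int p * c" using p(3) by auto
      then have "m - 1 = int p * c + 3" by simp
      then have "1 + of_bool (p = 3) * (of_int (m - 4) / 3) - of_int (m - 1) / 3 =
          (of_int (int p) * (of_int (- c) * (1 / 3)) :: rat)"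
        using False by (simp add: field_simps)
      then show ?thesis by (rule local_congI) (intro local_ints_mult local_ints_of_int 3 p)
    qed
  qed (simp add: nu_int_prime[OF p(1)])
  then show ?thesis
    using 1 2 pow qcong_if_local_cong[OF p(1) first_sum_cong[OF p n] order_refl]
      qcong_if_local_cong[OF p(1) second_sum_cong[OF p n] D]
    by (intro conjI allI impI; blast)
qed

end
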